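(* Let $n\ge2$, let $E/K$ be a field extension and let $F(\underline x)\in K[\underline x]=K[x_1,\dots,x_n]$ be a non-constant polynomial. Then the following are equivalent: (i) $F(\underline x)$ is indecomposable in $K[\underline x]$ but decomposable in $E[\underline x]$. (ii) (a) $K$ is of characteristic $p>0$ and $E/K$ is inseparable; (b) $F(\underline x)=b\,G(\underline x)^p+c$ for some $G(\underline x)\in E[\underline x]$ and $b,c\in K$; and (c) $G(\underline x)^p$ is indecomposable in $K[\underline x]$.
   Context: For an arbitrary field $L$ and $n\ge2$, a non-constant polynomial $F\in L[\underline x]$ is indecomposable in $L[\underline x]$ if it is not of the form $u(H(\underline x))$ with $H\in L[\underline x]$, $u\in L[t]$ and $\deg u\ge2$; otherwise it is decomposable in $L[\underline x]$. The extension $E/K$ is arbitrary (not assumed algebraic); inseparable means not separable, in the sense of separability of general (possibly transcendental) field extensions. In (ii), the polynomial $G$ in (c) is the one of (b); since $F$ is non-constant with coefficients in $K$, one has $b\ne0$ and $G^p\in K[\underline x]$. *)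

theory Defs
  imports "HOL-Library.Poly_Mapping" "HOL-Computational_Algebra.Polynomial"
begin

section \<open>Subfields of a field\<close>

text \<open>A field extension \<open>E/K\<close> is represented by two subfields \<open>K \<subseteq> E\<close> of an ambient field, which is
  a type of class \<^class>\<open>field\<close> (possibly \<open>E\<close> itself, when \<open>E = UNIV\<close>).\<close>

definition is_subfield :: "'a::field set \<Rightarrow> bool" where
  "is_subfield L \<longleftrightarrow> 0 \<in> L \<and> 1 \<in> L \<and>
     (\<forall>x\<in>L. \<forall>y\<in>L. x + y \<in> L \<and> x * y \<in> L) \<and> (\<forall>x\<in>L. - x \<in> L \<and> inverse x \<in> L)"

text \<open>The field \<open>L(S)\<close> generated by \<open>L\<close> and \<open>S\<close>.\<close>

definition adjoin :: "'a::field set \<Rightarrow> 'a set \<Rightarrow> 'a set" where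
  "adjoin L S = \<Inter>{M. is_subfield M \<and> L \<union> S \<subseteq> M}"


section \<open>Polynomials with coefficients in a subfield\<close>

definition poly_ring :: "'a::field set \<Rightarrow> 'a poly set" where
  "poly_ring L = {u. \<forall>i. coeff u i \<in> L}"

text \<open>A polynomial in variables indexed by \<open>'v\<close> maps each monomial (a finitely supported exponent
  vector, of type \<open>'v \<Rightarrow>\<^sub>0 nat\<close>) to its coefficient. The set \<open>mpoly_ring L V\<close> consists of those in
  which only variables from \<open>V\<close> and coefficients from \<open>L\<close> occur.\<close>

type_synonym ('v, 'a) mpol = "('v \<Rightarrow>\<^sub>0 nat) \<Rightarrow>\<^sub>0 'a"

definition mpoly_ring :: "'a::field set \<Rightarrow> 'v set \<Rightarrow> ('v, 'a) mpol set" where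
  "mpoly_ring L V = {P. \<forall>m\<in>Poly_Mapping.keys P.
     Poly_Mapping.lookup P m \<in> L \<and> Poly_Mapping.keys m \<subseteq> V}"

definition mpoly_const :: "'a::field \<Rightarrow> ('v, 'a) mpol" where
  "mpoly_const c = Poly_Mapping.single 0 c"

definition mpoly_eval :: "('v \<Rightarrow> 'a) \<Rightarrow> ('v, 'a::field) mpol \<Rightarrow> 'a" where
  "mpoly_eval f P = (\<Sum>m\<in>Poly_Mapping.keys P. Poly_Mapping.lookup P m *
     (\<Prod>v\<in>Poly_Mapping.keys m. f v ^ Poly_Mapping.lookup m v))"

text \<open>The composition \<open>u(H)\<close>.\<close>

definition mpoly_compose :: "'a::field poly \<Rightarrow> ('v, 'a) mpol \<Rightarrow> ('v, 'a) mpol" where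
  "mpoly_compose u H = poly (map_poly mpoly_const u) H"


section \<open>Decomposability in \<open>L[x\<^sub>v | v \<in> V]\<close>\<close>

text \<open>Both notions apply to non-constant elements of \<open>L[x\<^sub>v | v \<in> V]\<close> only.\<close>

definition decomposable :: "'a::field set \<Rightarrow> 'v set \<Rightarrow> ('v, 'a) mpol \<Rightarrow> bool" where
  "decomposable L V F \<longleftrightarrow> F \<in> mpoly_ring L V \<and> F \<notin> range mpoly_const \<and>
     (\<exists>H\<in>mpoly_ring L V. \<exists>u\<in>poly_ring L. degree u \<ge> 2 \<and> F = mpoly_compose u H)"

definition indecomposable :: "'a::field set \<Rightarrow> 'v set \<Rightarrow> ('v, 'a) mpol \<Rightarrow> bool" where
  "indecomposable L V F \<longleftrightarrow> F \<in> mpoly_ring L V \<and> F \<notin> range mpoly_const \<and>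
     \<not> (\<exists>H\<in>mpoly_ring L V. \<exists>u\<in>poly_ring L. degree u \<ge> 2 \<and> F = mpoly_compose u H)"


section \<open>Separable field extensions\<close>

definition is_min_poly :: "'a::field set \<Rightarrow> 'a \<Rightarrow> 'a poly \<Rightarrow> bool" where
  "is_min_poly L x P \<longleftrightarrow> P \<in> poly_ring L \<and> lead_coeff P = 1 \<and> poly P x = 0 \<and>
     (\<forall>Q\<in>poly_ring L. Q \<noteq> 0 \<longrightarrow> poly Q x = 0 \<longrightarrow> degree P \<le> degree Q)"

text \<open>\<open>x\<close> is algebraic over \<open>L\<close> and its minimal polynomial is prime to its derivative. Coprimality
  here is over the ambient field; by the Euclidean algorithm this is the same as coprimality
  in \<open>L[t]\<close>.\<close>

definition separable_over :: "'a::field set \<Rightarrow> 'a \<Rightarrow> bool" where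
  "separable_over L x \<longleftrightarrow> (\<exists>P. is_min_poly L x P \<and> coprime P (pderiv P))"

text \<open>The variables are indexed by the elements of the field, and the variable indexed by \<open>b\<close> is
  evaluated at \<open>b\<close>.\<close>

definition alg_independent :: "'a::field set \<Rightarrow> 'a set \<Rightarrow> bool" where
  "alg_independent K B \<longleftrightarrow> (\<forall>P\<in>mpoly_ring K B. mpoly_eval (\<lambda>b. b) P = 0 \<longrightarrow> P = 0)"

text \<open>\<open>M/K\<close> has a separating transcendence basis \<open>B\<close>.\<close>

definition separably_generated :: "'a::field set \<Rightarrow> 'a set \<Rightarrow> bool" where
  "separably_generated K M \<longleftrightarrow>
     (\<exists>B\<subseteq>M. alg_independent K B \<and> (\<forall>x\<in>M. separable_over (adjoin K B) x))"

text \<open>Separability of a general, possibly transcendental, extension \<open>E/K\<close>: every subextension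
  that is finitely generated over \<open>K\<close> is separably generated over \<open>K\<close>.\<close>

definition separable_extension :: "'a::field set \<Rightarrow> 'a set \<Rightarrow> bool" where
  "separable_extension K E \<longleftrightarrow>
     (\<forall>S. finite S \<longrightarrow> S \<subseteq> E \<longrightarrow> separably_generated K (adjoin K S))"

end

theory Submission
  imports Defs "HOL-Computational_Algebra.Polynomial_Factorial"
    "HOL-Computational_Algebra.Formal_Power_Series"
begin

text \<open>
If \<open>F = b G\<^sup>p + c\<close>, then \<open>F\<close> is a value of \<open>b t\<^sup>p + c\<close> over \<open>E\<close>, while affine changes with coefficients
in \<open>K\<close> do not affect indecomposability over \<open>K\<close>; so (ii) implies (i).

For the converse let \<open>F = u(H)\<close> over \<open>E\<close> with \<open>deg u \<ge> 2\<close>. The heart of the proof is that \<open>F\<close> is already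
decomposable over \<open>K\<close> as soon as some exponent of some monomial of \<open>F\<close> is non-zero in \<open>K\<close>
(\<open>separable_descent\<close>). If there is no such exponent, the characteristic is \<open>p > 0\<close>, \<open>F\<close> is a polynomial
in the \<open>x\<^sub>v\<^sup>p\<close>, and so is \<open>H\<close>, unless \<open>u\<close> is a polynomial in \<open>t\<^sup>p\<close>, in which case \<open>H\<^sup>p\<close> can take the
place of \<open>H\<close>. Replacing \<open>x\<^sub>v\<^sup>p\<close> by \<open>x\<^sub>v\<close> lowers the degree of \<open>F\<close>, and the process ends with a decomposition
over \<open>K\<close> or with \<open>F = b G\<^sup>p + c\<close> (\<open>decomposition_descends_or_power\<close>). As \<open>F\<close> is indecomposable over \<open>K\<close>,
the second case occurs and \<open>G\<close> has a coefficient \<open>g \<notin> K\<close> with \<open>g\<^sup>p \<in> K\<close>. An algebraically independent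
subset of \<open>K(g)\<close> is empty, and \<open>g\<close> is inseparable over \<open>K\<close>, so \<open>K(g)\<close> has no separating transcendence
basis (\<open>pth_root_not_separable\<close>).

The proof of \<open>separable_descent\<close> goes as follows. Restrict \<open>F\<close> to a curve \<open>x\<^sub>v = t\<^bsup>N v\<^esup>\<close>, where it becomes a
polynomial \<open>f(t)\<close> with \<open>f' \<noteq> 0\<close>, and let \<open>s\<close> be a parameter that moves points away from the curve. By
Hensel's lemma the equation \<open>f(\<Theta>) = F\<close> has a unique solution \<open>\<Theta>\<close>, a power series in \<open>s\<close>, with \<open>\<Theta> = t\<close> on
the curve: \<open>\<Theta>\<close> is the projection onto the curve along the fibres of \<open>F\<close>. By the same uniqueness
\<open>H = h(\<Theta>)\<close> for the restriction \<open>h\<close> of \<open>H\<close>. The condition that a polynomial \<open>P\<close> with restriction \<open>p\<close>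
to the curve satisfies \<open>P = p(\<Theta>)\<close> is linear and defined over \<open>K\<close>, so it passes from \<open>H\<close> to the components
of \<open>H\<close> with respect to a \<open>K\<close>-linearly independent family. Some component \<open>P\<close> is non-constant on the curve, and its
restriction has smaller degree than \<open>f\<close>. Now consider the ring \<open>W\<close> of all \<open>w \<in> K[t]\<close> for which \<open>w(\<Theta>)\<close>
is a fraction of polynomials in the \<open>x\<^sub>v\<close>. By a polynomial version of Lueroth's theorem
(\<open>lueroth_polynomial\<close>) \<open>W = K[q]\<close> for some \<open>q\<close>. So \<open>f = a(q)\<close>, and \<open>deg a \<ge> 2\<close> because \<open>W\<close> contains a
non-constant polynomial of degree less than \<open>deg f\<close>. The fraction \<open>q(\<Theta>)\<close> is a root of \<open>a(T) - F\<close>, hence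
integral over the polynomial ring, hence a polynomial \<open>Q\<close>
(\<open>mpoly_completely_integrally_closed\<close>), and \<open>F = a(Q)\<close> is a decomposition over \<open>K\<close>.
\<close>

section \<open>Ring homomorphisms and evaluation of polynomials\<close>

locale comm_ring_hom =
  fixes h :: "'r::comm_ring_1 \<Rightarrow> 's::comm_ring_1"
  assumes hom_add: "h (x + y) = h x + h y"
    and hom_mult: "h (x * y) = h x * h y"
    and hom_one: "h 1 = 1"
begin

lemma hom_zero: "h 0 = 0"
  using hom_add[of 0 0] by simp

lemma hom_uminus: "h (- x) = - h x"
  using hom_add[of x "- x"] hom_zero by (simp add: eq_neg_iff_add_eq_0 add.commute)

lemma hom_diff: "h (x - y) = h x - h y"
  using hom_add[of x "- y"] by (simp add: hom_uminus)

lemma hom_power: "h (x ^ n) = h x ^ n"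
  by (induction n) (simp_all add: hom_one hom_mult)

lemma hom_sum: "h (sum f A) = (\<Sum>x\<in>A. h (f x))"
  by (induction A rule: infinite_finite_induct) (simp_all add: hom_zero hom_add)

lemma hom_prod: "h (prod f A) = (\<Prod>x\<in>A. h (f x))"
  by (induction A rule: infinite_finite_induct) (simp_all add: hom_one hom_mult)

lemma map_poly_hom: "comm_ring_hom (map_poly h)"
proof
  fix p q :: "'r poly"
  show "map_poly h (p + q) = map_poly h p + map_poly h q"
    by (rule poly_eqI) (simp add: coeff_map_poly hom_zero hom_add)
  show "map_poly h (p * q) = map_poly h p * map_poly h q"
    by (rule poly_eqI) (simp add: coeff_map_poly hom_zero hom_mult hom_sum coeff_mult)
  show "map_poly h 1 = 1"
    by (simp add: hom_one)
qed

lemma hom_poly: "h (poly p x) = poly (map_poly h p) (h x)"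
  by (induction p) (simp_all add: hom_zero hom_add hom_mult map_poly_pCons)

end

lemma comm_ring_hom_comp:
  assumes "comm_ring_hom f" and "comm_ring_hom g"
  shows "comm_ring_hom (\<lambda>x. f (g x))"
proof -
  interpret f: comm_ring_hom f by fact
  interpret g: comm_ring_hom g by fact
  show ?thesis
    by unfold_locales (simp_all add: f.hom_add g.hom_add f.hom_mult g.hom_mult f.hom_one g.hom_one)
qed

lemma comm_ring_hom_poly: "comm_ring_hom (\<lambda>p. poly p x)"
  by unfold_locales simp_all

lemma comm_ring_hom_const_poly: "comm_ring_hom (\<lambda>a. [:a:])"
  by unfold_locales (simp_all add: one_pCons)

lemma comm_ring_hom_fps_const: "comm_ring_hom fps_const"
  by unfold_locales simp_all

lemma comm_ring_hom_mpoly_const: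
  "comm_ring_hom (mpoly_const :: 'a::field \<Rightarrow> ('v, 'a) mpol)"
  by unfold_locales (simp_all add: mpoly_const_def single_add mult_single)

text \<open>The coefficients act through a structure map \<open>k\<close>, so that one notion covers substitution into
multivariate polynomials, into polynomials in one variable and into power series.\<close>

definition peval :: "('r::comm_ring_1 \<Rightarrow> 's::comm_ring_1) \<Rightarrow> 's \<Rightarrow> 'r poly \<Rightarrow> 's" where
  "peval k x p = poly (map_poly k p) x"

lemma comm_ring_hom_peval: "comm_ring_hom k \<Longrightarrow> comm_ring_hom (peval k x)"
  unfolding peval_def
  by (rule comm_ring_hom_comp[OF comm_ring_hom_poly comm_ring_hom.map_poly_hom])

lemma peval_const: "comm_ring_hom k \<Longrightarrow> peval k x [:a:] = k a"
  by (simp add: peval_def map_poly_pCons comm_ring_hom.hom_zero)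

lemma peval_X: "comm_ring_hom k \<Longrightarrow> peval k x [:0, 1:] = x"
  by (simp add: peval_def map_poly_pCons comm_ring_hom.hom_zero comm_ring_hom.hom_one)

lemma peval_altdef:
  assumes "comm_ring_hom k"
  shows "peval k x p = (\<Sum>i\<le>degree p. k (coeff p i) * x ^ i)"
proof -
  interpret comm_ring_hom k by fact
  have "peval k x p = (\<Sum>i\<le>degree (map_poly k p). coeff (map_poly k p) i * x ^ i)"
    by (simp add: peval_def poly_altdef)
  also have "\<dots> = (\<Sum>i\<le>degree p. coeff (map_poly k p) i * x ^ i)"
    by (rule sum.mono_neutral_left) (use map_poly_degree_leq in \<open>auto simp: coeff_eq_0\<close>)
  finally show ?thesis by (simp add: coeff_map_poly hom_zero)
qed

lemma hom_peval:
  assumes "comm_ring_hom h" and "comm_ring_hom k"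
  shows "h (peval k x p) = peval (\<lambda>a. h (k a)) (h x) p"
  using assms
  by (simp add: peval_def comm_ring_hom.hom_poly map_poly_map_poly comm_ring_hom.hom_zero o_def)

lemma pcompose_eq_peval: "pcompose p q = peval (\<lambda>a. [:a:]) q p"
  by (simp add: peval_def pcompose_altdef)

lemma mpoly_compose_eq_peval: "mpoly_compose u H = peval mpoly_const H u"
  by (simp add: peval_def mpoly_compose_def)

lemma peval_peval:
  assumes "comm_ring_hom k"
  shows "peval k x (pcompose p q) = peval k (peval k x q) p"
  using hom_peval[OF comm_ring_hom_peval[OF assms] comm_ring_hom_const_poly]
  by (simp add: pcompose_eq_peval peval_const[OF assms])

lemma sum_single_lookup:
  "(\<Sum>m\<in>Poly_Mapping.keys P. Poly_Mapping.single m (Poly_Mapping.lookup P m)) = P"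
  by (rule poly_mapping_eqI)
    (simp add: lookup_sum lookup_single when_def sum.delta in_keys_iff)

definition mono_eval :: "('v \<Rightarrow> 's::comm_ring_1) \<Rightarrow> ('v \<Rightarrow>\<^sub>0 nat) \<Rightarrow> 's" where
  "mono_eval X m = (\<Prod>v\<in>Poly_Mapping.keys m. X v ^ Poly_Mapping.lookup m v)"

definition meval :: "('a::field \<Rightarrow> 's::comm_ring_1) \<Rightarrow> ('v \<Rightarrow> 's) \<Rightarrow> ('v, 'a) mpol \<Rightarrow> 's" where
  "meval k X P = (\<Sum>m\<in>Poly_Mapping.keys P. k (Poly_Mapping.lookup P m) * mono_eval X m)"

definition mvar :: "'v \<Rightarrow> ('v, 'a::field) mpol" where
  "mvar v = Poly_Mapping.single (Poly_Mapping.single v 1) 1"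

lemma mono_eval_superset:
  assumes "finite S" and "Poly_Mapping.keys m \<subseteq> S"
  shows "mono_eval X m = (\<Prod>v\<in>S. X v ^ Poly_Mapping.lookup m v)"
  unfolding mono_eval_def
  by (rule prod.mono_neutral_left) (use assms in \<open>auto simp: in_keys_iff\<close>)

lemma mono_eval_add: "mono_eval X (m + m') = mono_eval X m * mono_eval X m'"
proof -
  let ?S = "Poly_Mapping.keys m \<union> Poly_Mapping.keys m'"
  have "mono_eval X (m + m') = (\<Prod>v\<in>?S. X v ^ Poly_Mapping.lookup (m + m') v)"
    by (rule mono_eval_superset) (auto simp: keys_add)
  also have "\<dots> = (\<Prod>v\<in>?S. X v ^ Poly_Mapping.lookup m v) * (\<Prod>v\<in>?S. X v ^ Poly_Mapping.lookup m' v)"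
    by (simp add: lookup_add power_add prod.distrib)
  also have "\<dots> = mono_eval X m * mono_eval X m'"
    by (simp add: mono_eval_superset[of ?S m] mono_eval_superset[of ?S m'])
  finally show ?thesis .
qed

lemma mono_eval_zero [simp]: "mono_eval X 0 = 1"
  by (simp add: mono_eval_def)

lemma mono_eval_single [simp]: "mono_eval X (Poly_Mapping.single v n) = X v ^ n"
  by (simp add: mono_eval_def)

context
  fixes k :: "'a::field \<Rightarrow> 's::comm_ring_1"
  assumes k: "comm_ring_hom k"
begin

interpretation k: comm_ring_hom k by (rule k)

lemma meval_superset:
  assumes "finite S" and "Poly_Mapping.keys P \<subseteq> S"
  shows "meval k X P = (\<Sum>m\<in>S. k (Poly_Mapping.lookup P m) * mono_eval X m)"
  unfolding meval_def
  by (rule sum.mono_neutral_left) (use assms in \<open>auto simp: in_keys_iff k.hom_zero\<close>)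

lemma meval_single: "meval k X (Poly_Mapping.single m a) = k a * mono_eval X m"
  by (simp add: meval_superset[of "{m}"])

lemma meval_add: "meval k X (P + Q) = meval k X P + meval k X Q"
proof -
  let ?S = "Poly_Mapping.keys P \<union> Poly_Mapping.keys Q"
  have "meval k X (P + Q) = (\<Sum>m\<in>?S. k (Poly_Mapping.lookup (P + Q) m) * mono_eval X m)"
    by (rule meval_superset) (auto simp: keys_add)
  then show ?thesis
    by (simp add: meval_superset[of ?S P] meval_superset[of ?S Q] lookup_add k.hom_add
        distrib_right sum.distrib)
qed

lemma meval_sum: "meval k X (sum f A) = (\<Sum>i\<in>A. meval k X (f i))"
  by (induction A rule: infinite_finite_induct) (simp_all add: meval_add, simp_all add: meval_def)

lemma meval_mult: "meval k X (P * Q) = meval k X P * meval k X Q"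
proof -
  have "P * Q = (\<Sum>m\<in>Poly_Mapping.keys P. Poly_Mapping.single m (Poly_Mapping.lookup P m)) *
      (\<Sum>m\<in>Poly_Mapping.keys Q. Poly_Mapping.single m (Poly_Mapping.lookup Q m))"
    by (simp add: sum_single_lookup)
  also have "\<dots> = (\<Sum>m\<in>Poly_Mapping.keys P. \<Sum>m'\<in>Poly_Mapping.keys Q.
      Poly_Mapping.single (m + m') (Poly_Mapping.lookup P m * Poly_Mapping.lookup Q m'))"
    by (simp add: sum_product mult_single)
  finally have "meval k X (P * Q) = (\<Sum>m\<in>Poly_Mapping.keys P. \<Sum>m'\<in>Poly_Mapping.keys Q.
      (k (Poly_Mapping.lookup P m) * mono_eval X m) * (k (Poly_Mapping.lookup Q m') * mono_eval X m'))"
    by (simp add: meval_sum meval_single k.hom_mult mono_eval_add mult_ac)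
  then show ?thesis by (simp add: meval_def sum_product)
qed

lemma meval_const: "meval k X (mpoly_const a) = k a"
  by (simp add: mpoly_const_def meval_single)

lemma comm_ring_hom_meval: "comm_ring_hom (meval k X)"
proof
  show "meval k X 1 = 1"
    using meval_single[of X 0 1] by (simp add: k.hom_one)
qed (simp_all add: meval_add meval_mult)

lemma meval_var: "meval k X (mvar v) = X v"
  by (simp add: mvar_def meval_single k.hom_one)

end

lemma hom_mono_eval: "comm_ring_hom h \<Longrightarrow> h (mono_eval X m) = mono_eval (\<lambda>v. h (X v)) m"
  by (simp add: mono_eval_def comm_ring_hom.hom_prod comm_ring_hom.hom_power)

lemma hom_meval:
  assumes "comm_ring_hom h"
  shows "h (meval k X P) = meval (\<lambda>a. h (k a)) (\<lambda>v. h (X v)) P"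
  using assms
  by (simp add: meval_def comm_ring_hom.hom_sum comm_ring_hom.hom_mult hom_mono_eval)

lemma mono_eval_mvar: "mono_eval mvar m = Poly_Mapping.single m (1::'a::field)"
proof -
  have pow: "mvar v ^ n = Poly_Mapping.single (Poly_Mapping.single v n) (1::'a)" for v :: 'b and n
    by (induction n)
      (simp_all add: mvar_def mult_single flip: single_add)
  have "(\<Prod>v\<in>S. Poly_Mapping.single (Poly_Mapping.single v (Poly_Mapping.lookup m v)) (1::'a)) =
      Poly_Mapping.single (\<Sum>v\<in>S. Poly_Mapping.single v (Poly_Mapping.lookup m v)) 1"
    if "finite S" for S
    using that by (induction S) (simp_all add: mult_single)
  then show ?thesis
    by (simp add: mono_eval_def pow sum_single_lookup)
qed

lemma meval_mvar: "meval mpoly_const mvar P = P"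
proof -
  have "meval mpoly_const mvar P =
      (\<Sum>m\<in>Poly_Mapping.keys P. Poly_Mapping.single m (Poly_Mapping.lookup P m))"
    by (simp add: meval_def mono_eval_mvar mpoly_const_def mult_single)
  then show ?thesis by (simp add: sum_single_lookup)
qed

section \<open>Coefficients in a subring\<close>

text \<open>The field \<open>K\<close> is only a subset of a type, so rationality over \<open>K\<close> is expressed by membership of all
coefficients in a subring. Each construction below comes with a lemma that it preserves such
subrings.\<close>

definition is_subring :: "'r::comm_ring_1 set \<Rightarrow> bool" where
  "is_subring S \<longleftrightarrow> 1 \<in> S \<and> - 1 \<in> S \<and> (\<forall>x\<in>S. \<forall>y\<in>S. x + y \<in> S \<and> x * y \<in> S)"

definition polys_over :: "'r::comm_ring_1 set \<Rightarrow> 'r poly set" where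
  "polys_over S = {p. \<forall>i. coeff p i \<in> S}"

definition series_over :: "'r::comm_ring_1 set \<Rightarrow> 'r fps set" where
  "series_over S = {A. \<forall>i. fps_nth A i \<in> S}"

context
  fixes S :: "'r::comm_ring_1 set"
  assumes S: "is_subring S"
begin

lemma subring_1: "1 \<in> S" and subring_add: "x \<in> S \<Longrightarrow> y \<in> S \<Longrightarrow> x + y \<in> S"
  and subring_mult: "x \<in> S \<Longrightarrow> y \<in> S \<Longrightarrow> x * y \<in> S"
  using S by (auto simp: is_subring_def)

lemma subring_uminus: "x \<in> S \<Longrightarrow> - x \<in> S"
  using S by (metis is_subring_def mult_minus1)

lemma subring_diff: "x \<in> S \<Longrightarrow> y \<in> S \<Longrightarrow> x - y \<in> S"
  using subring_add[of x "- y"] subring_uminus by simp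

lemma subring_0: "0 \<in> S"
  using subring_diff[OF subring_1 subring_1] by simp

lemma subring_power: "x \<in> S \<Longrightarrow> x ^ n \<in> S"
  by (induction n) (auto intro: subring_1 subring_mult)

lemma subring_sum: "(\<And>i. i \<in> A \<Longrightarrow> f i \<in> S) \<Longrightarrow> sum f A \<in> S"
  by (induction A rule: infinite_finite_induct) (auto intro: subring_0 subring_add)

lemma subring_prod: "(\<And>i. i \<in> A \<Longrightarrow> f i \<in> S) \<Longrightarrow> prod f A \<in> S"
  by (induction A rule: infinite_finite_induct) (auto intro: subring_1 subring_mult)

lemma subring_of_nat: "of_nat n \<in> S"
  by (induction n) (auto intro: subring_0 subring_1 subring_add)

lemma polys_over_pCons: "pCons a p \<in> polys_over S \<longleftrightarrow> a \<in> S \<and> p \<in> polys_over S"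
  by (auto simp: polys_over_def coeff_pCons split: nat.splits)

lemma is_subring_polys_over: "is_subring (polys_over S)"
  unfolding is_subring_def polys_over_def
  by (auto simp: coeff_mult coeff_1 subring_0 subring_1 subring_uminus
      intro!: subring_add subring_sum subring_mult)

lemma is_subring_series_over: "is_subring (series_over S)"
  unfolding is_subring_def series_over_def
  by (auto simp: fps_mult_nth subring_0 subring_1 subring_uminus
      intro!: subring_add subring_sum subring_mult)

lemma monom_polys_over: "a \<in> S \<Longrightarrow> monom a n \<in> polys_over S"
  by (simp add: polys_over_def subring_0)

lemma smult_polys_over: "a \<in> S \<Longrightarrow> p \<in> polys_over S \<Longrightarrow> smult a p \<in> polys_over S"
  by (simp add: polys_over_def subring_mult)

lemma poly_in_subring: "p \<in> polys_over S \<Longrightarrow> x \<in> S \<Longrightarrow> poly p x \<in> S"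
  unfolding poly_altdef by (auto simp: polys_over_def intro!: subring_sum subring_mult subring_power)

lemma peval_in_subring:
  assumes "comm_ring_hom k" and "p \<in> polys_over T" and "k ` T \<subseteq> S" and "x \<in> S"
  shows "peval k x p \<in> S"
  unfolding peval_altdef[OF assms(1)] using assms(2-4)
  by (auto simp: polys_over_def intro!: subring_sum subring_mult subring_power)

end

lemma pderiv_polys_over:
  fixes S :: "'r::idom set"
  assumes "is_subring S" and "p \<in> polys_over S"
  shows "pderiv p \<in> polys_over S"
  using assms(2) subring_mult[OF assms(1) subring_of_nat[OF assms(1)]]
  by (auto simp: polys_over_def coeff_pderiv simp del: of_nat_Suc)

lemma meval_in_subring:
  assumes "is_subring S" and "P \<in> mpoly_ring K V" and "k ` K \<subseteq> S" and "\<And>v. v \<in> V \<Longrightarrow> X v \<in> S"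
  shows "meval k X P \<in> S"
  unfolding meval_def mono_eval_def
proof (intro subring_sum[OF assms(1)] subring_mult[OF assms(1)] subring_prod[OF assms(1)]
    subring_power[OF assms(1)])
  fix m assume m: "m \<in> Poly_Mapping.keys P"
  show "k (Poly_Mapping.lookup P m) \<in> S"
    using m assms(2,3) by (auto simp: mpoly_ring_def)
  fix v assume "v \<in> Poly_Mapping.keys m"
  then show "X v \<in> S" using m assms(2,4) by (auto simp: mpoly_ring_def)
qed

lemma is_subring_subfield: "is_subfield K \<Longrightarrow> is_subring K"
  by (simp add: is_subring_def is_subfield_def)

lemma is_subring_mpoly_ring:
  fixes K :: "'a::field set" and V :: "'v set"
  assumes "is_subfield K"
  shows "is_subring (mpoly_ring K V)"
proof -
  have K: "is_subring K" using assms by (rule is_subring_subfield)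
  have lookupK: "Poly_Mapping.lookup P m \<in> K" if "P \<in> mpoly_ring K V" for P :: "('v, 'a) mpol" and m
    using that subring_0[OF K] by (cases "m \<in> Poly_Mapping.keys P") (auto simp: mpoly_ring_def in_keys_iff)
  show ?thesis
    unfolding is_subring_def
  proof (intro conjI ballI)
    show "1 \<in> mpoly_ring K V"
      using subring_1[OF K] by (auto simp: mpoly_ring_def lookup_one)
    show "- 1 \<in> mpoly_ring K V"
      using subring_1[OF K] subring_uminus[OF K] subring_0[OF K]
      by (auto simp: mpoly_ring_def lookup_one when_def in_keys_iff split: if_splits)
  next
    fix P Q :: "('v, 'a) mpol" assume P: "P \<in> mpoly_ring K V" and Q: "Q \<in> mpoly_ring K V"
    show "P + Q \<in> mpoly_ring K V"
      using P Q keys_add[of P Q] lookupK[OF P] lookupK[OF Q] subring_add[OF K]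
      by (auto simp: mpoly_ring_def lookup_add)
    have single: "Poly_Mapping.lookup (Poly_Mapping.single m a) m' \<in> K" if "a \<in> K" for m m' :: "'v \<Rightarrow>\<^sub>0 nat" and a
      using that subring_0[OF K] by (simp add: lookup_single when_def)
    have "P * Q = (\<Sum>m\<in>Poly_Mapping.keys P. Poly_Mapping.single m (Poly_Mapping.lookup P m)) *
        (\<Sum>m\<in>Poly_Mapping.keys Q. Poly_Mapping.single m (Poly_Mapping.lookup Q m))"
      by (simp add: sum_single_lookup)
    then have PQ: "P * Q = (\<Sum>m\<in>Poly_Mapping.keys P. \<Sum>m'\<in>Poly_Mapping.keys Q.
        Poly_Mapping.single (m + m') (Poly_Mapping.lookup P m * Poly_Mapping.lookup Q m'))"
      by (simp add: sum_product mult_single)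
    have "Poly_Mapping.lookup (P * Q) m \<in> K" for m
      unfolding PQ lookup_sum
      by (intro subring_sum[OF K] single subring_mult[OF K] lookupK P Q)
    moreover have "Poly_Mapping.keys m \<subseteq> V" if m: "m \<in> Poly_Mapping.keys (P * Q)" for m
    proof -
      from m obtain a b where ab: "m = a + b" "a \<in> Poly_Mapping.keys P" "b \<in> Poly_Mapping.keys Q"
        using keys_mult[of P Q] by blast
      then show ?thesis
        using P Q keys_add[of a b] unfolding mpoly_ring_def by blast
    qed
    ultimately show "P * Q \<in> mpoly_ring K V" by (simp add: mpoly_ring_def)
  qed
qed

lemma poly_ring_eq_polys_over: "poly_ring K = polys_over K"
  by (simp add: poly_ring_def polys_over_def)

lemma mpoly_ring_lookup: "is_subfield K \<Longrightarrow> P \<in> mpoly_ring K V \<Longrightarrow> Poly_Mapping.lookup P m \<in> K"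
  by (cases "m \<in> Poly_Mapping.keys P") (auto simp: mpoly_ring_def in_keys_iff is_subfield_def)

lemma mpoly_ring_const: "is_subfield K \<Longrightarrow> a \<in> K \<Longrightarrow> mpoly_const a \<in> mpoly_ring K V"
  by (auto simp: mpoly_ring_def mpoly_const_def)

lemma mpoly_ring_mvar: "is_subfield K \<Longrightarrow> v \<in> V \<Longrightarrow> mvar v \<in> mpoly_ring K V"
  by (auto simp: mpoly_ring_def mvar_def is_subfield_def)

section \<open>Weights separating monomials\<close>

definition weight :: "(nat \<Rightarrow> nat) \<Rightarrow> (nat \<Rightarrow>\<^sub>0 nat) \<Rightarrow> nat" where
  "weight N m = (\<Sum>v\<in>Poly_Mapping.keys m. N v * Poly_Mapping.lookup m v)"

lemma mono_eval_monom: "mono_eval (\<lambda>v. monom (1::'r::comm_ring_1) (N v)) m = monom 1 (weight N m)"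
proof -
  have "(\<Prod>v\<in>S. monom (1::'r) (N v) ^ Poly_Mapping.lookup m v) =
      monom 1 (\<Sum>v\<in>S. N v * Poly_Mapping.lookup m v)" if "finite S" for S
    using that by (induction S) (simp_all add: monom_power mult_monom)
  then show ?thesis by (simp add: mono_eval_def weight_def)
qed

lemma digit_expansion_unique:
  fixes a b :: "nat \<Rightarrow> nat"
  assumes "\<And>i. i < n \<Longrightarrow> a i < D" and "\<And>i. i < n \<Longrightarrow> b i < D"
    and "(\<Sum>i<n. a i * D ^ i) = (\<Sum>i<n. b i * D ^ i)" and "i < n"
  shows "a i = b i"
  using assms
proof (induction n arbitrary: a b i)
  case 0
  then show ?case by simp
next
  case (Suc n)
  let ?A = "\<Sum>i<n. a (Suc i) * D ^ i" and ?B = "\<Sum>i<n. b (Suc i) * D ^ i"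
  have D: "D > 0" using Suc.prems(1)[of 0] by simp
  have shift: "(\<Sum>i<Suc n. f i * D ^ i) = f 0 + D * (\<Sum>i<n. f (Suc i) * D ^ i)" for f :: "nat \<Rightarrow> nat"
    by (subst sum.lessThan_Suc_shift) (simp add: sum_distrib_left mult_ac)
  have eq: "a 0 + D * ?A = b 0 + D * ?B"
    using Suc.prems(3) unfolding shift .
  have "a 0 = (a 0 + D * ?A) mod D" "b 0 = (b 0 + D * ?B) mod D"
    using Suc.prems(1)[of 0] Suc.prems(2)[of 0] by simp_all
  with eq have zero: "a 0 = b 0" by simp
  with eq D have "?A = ?B" by simp
  with Suc.prems have "a (Suc j) = b (Suc j)" if "j < n" for j
    using that by (intro Suc.IH[of "\<lambda>i. a (Suc i)" "\<lambda>i. b (Suc i)" j]) auto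
  with zero Suc.prems(4) show ?case by (cases i) auto
qed

text \<open>The weights are powers of a large base \<open>D\<close>, so that the weight of a monomial lists its exponents as
digits. The variable \<open>x\<^sub>j\<close> receives the digit of place value \<open>1\<close> and \<open>D\<close> is a multiple of \<open>c\<close>, so modulo \<open>c\<close>
the weight of a monomial is its exponent at \<open>j\<close>: with \<open>c\<close> the characteristic, differentiation with
respect to \<open>t\<close> after \<open>x\<^sub>v \<mapsto> t\<^bsup>N v\<^esup>\<close> still detects that exponent.\<close>

lemma separating_weights:
  assumes "finite A" and "c > 0"
  obtains N where "inj_on (weight N) A" and "N j = 1" and "\<forall>i. i \<noteq> j \<longrightarrow> c dvd N i"
    and "\<forall>i. N i > 0"
proof -
  \<comment> \<open>The place of the digit of \<open>x\<^sub>v\<close>; the transposition of \<open>0\<close> and \<open>j\<close> puts \<open>x\<^sub>j\<close> at place \<open>0\<close>.\<close>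
  define e where "e = (\<lambda>v. if v = j then 0 else if v = 0 then j else v)"
  have ee: "e (e v) = v" for v by (auto simp: e_def)
  have e_inj: "inj_on e X" for X by (rule inj_on_inverseI[of _ e]) (rule ee)
  define D where "D = c * Suc (\<Sum>m\<in>A. \<Sum>v\<in>Poly_Mapping.keys m. Poly_Mapping.lookup m v)"
  define L where "L = Suc (\<Sum>m\<in>A. \<Sum>v\<in>Poly_Mapping.keys m. e v)"
  define N where "N = (\<lambda>v. D ^ e v)"
  have Dpos: "D > 0" using assms(2) by (simp add: D_def)
  have digit: "Poly_Mapping.lookup m v < D" if "m \<in> A" for m v
  proof (cases "v \<in> Poly_Mapping.keys m")
    case True
    have "Poly_Mapping.lookup m v \<le> (\<Sum>v\<in>Poly_Mapping.keys m. Poly_Mapping.lookup m v)"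
      using True by (intro member_le_sum) auto
    also have "\<dots> \<le> (\<Sum>m\<in>A. \<Sum>v\<in>Poly_Mapping.keys m. Poly_Mapping.lookup m v)"
      using that assms(1) by (intro member_le_sum[of m A "\<lambda>m. \<Sum>v\<in>Poly_Mapping.keys m. Poly_Mapping.lookup m v"]) auto
    also have "\<dots> < D" using assms(2) unfolding D_def by (cases c) auto
    finally show ?thesis .
  next
    case False
    then show ?thesis using Dpos by (simp add: in_keys_iff)
  qed
  have position: "e v < L" if "m \<in> A" "v \<in> Poly_Mapping.keys m" for m v
  proof -
    have "e v \<le> (\<Sum>v\<in>Poly_Mapping.keys m. e v)"
      using that(2) by (intro member_le_sum) auto
    also have "\<dots> \<le> (\<Sum>m\<in>A. \<Sum>v\<in>Poly_Mapping.keys m. e v)"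
      using that(1) assms(1) by (intro member_le_sum[of m A "\<lambda>m. \<Sum>v\<in>Poly_Mapping.keys m. e v"]) auto
    finally show ?thesis by (simp add: L_def)
  qed
  have expand: "weight N m = (\<Sum>i<L. Poly_Mapping.lookup m (e i) * D ^ i)" if "m \<in> A" for m
  proof -
    have "(\<Sum>i<L. Poly_Mapping.lookup m (e i) * D ^ i) =
        (\<Sum>i\<in>e ` Poly_Mapping.keys m. Poly_Mapping.lookup m (e i) * D ^ i)"
    proof (rule sum.mono_neutral_right)
      show "e ` Poly_Mapping.keys m \<subseteq> {..<L}" using position[OF that] by auto
      show "\<forall>i\<in>{..<L} - e ` Poly_Mapping.keys m. Poly_Mapping.lookup m (e i) * D ^ i = 0"
      proof
        fix i assume "i \<in> {..<L} - e ` Poly_Mapping.keys m"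
        then have "e i \<notin> Poly_Mapping.keys m" by (metis DiffD2 ee imageI)
        then show "Poly_Mapping.lookup m (e i) * D ^ i = 0" by (simp add: in_keys_iff)
      qed
    qed simp
    also have "\<dots> = weight N m"
      by (simp add: sum.reindex[OF e_inj] ee weight_def N_def mult.commute)
    finally show ?thesis by simp
  qed
  have "inj_on (weight N) A"
  proof (rule inj_onI)
    fix m m' assume m: "m \<in> A" and m': "m' \<in> A" and eq: "weight N m = weight N m'"
    show "m = m'"
    proof (rule poly_mapping_eqI)
      fix v
      show "Poly_Mapping.lookup m v = Poly_Mapping.lookup m' v"
      proof (cases "e v < L")
        case True
        have "Poly_Mapping.lookup m (e (e v)) = Poly_Mapping.lookup m' (e (e v))"
          by (rule digit_expansion_unique[of L "\<lambda>i. Poly_Mapping.lookup m (e i)" D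
                "\<lambda>i. Poly_Mapping.lookup m' (e i)"])
            (use eq expand[OF m] expand[OF m'] digit m m' True in auto)
        then show ?thesis by (simp add: ee)
      next
        case False
        then have "v \<notin> Poly_Mapping.keys m" "v \<notin> Poly_Mapping.keys m'"
          using position m m' by blast+
        then show ?thesis by (simp add: in_keys_iff)
      qed
    qed
  qed
  moreover have "N j = 1" by (simp add: N_def e_def)
  moreover have "c dvd N i" if "i \<noteq> j" for i
  proof -
    have "e i \<noteq> 0" using that by (auto simp: e_def)
    then have "D dvd N i" by (simp add: N_def)
    then show ?thesis unfolding D_def by (rule dvd_mult_left)
  qed
  moreover have "N i > 0" for i using Dpos by (simp add: N_def)
  ultimately show thesis using that by blast
qed

section \<open>Division with remainder over a subring\<close>

text \<open>The leading coefficient of the divisor need not be invertible in \<open>S\<close>; multiplying the dividend by a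
power of it keeps quotient and remainder over \<open>S\<close>.\<close>

lemma pseudo_division:
  fixes S :: "'r::idom set"
  assumes S: "is_subring S" and A: "A \<in> polys_over S" and B: "B \<in> polys_over S" "B \<noteq> 0"
  obtains e Q R where "Q \<in> polys_over S" and "R \<in> polys_over S"
    and "smult (lead_coeff B ^ e) A = Q * B + R" and "R = 0 \<or> degree R < degree B"
proof -
  note SP = is_subring_polys_over[OF S]
  have lead: "coeff p i \<in> S" if "p \<in> polys_over S" for p i
    using that by (simp add: polys_over_def)
  have "\<exists>e Q R. Q \<in> polys_over S \<and> R \<in> polys_over S \<and> smult (lead_coeff B ^ e) A = Q * B + R \<and>
      (R = 0 \<or> degree R < degree B)" if "A \<in> polys_over S" "A = 0 \<or> degree A < n" for A n
    using that
  proof (induction n arbitrary: A)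
    case 0
    then show ?case
      by (intro exI[of _ 0] exI[of _ 0] exI[of _ 0]) (simp add: subring_0[OF SP])
  next
    case (Suc n)
    show ?case
    proof (cases "degree A = n \<and> degree B \<le> n")
      case False
      show ?thesis
      proof (cases "A = 0 \<or> degree A < n")
        case True
        then show ?thesis using Suc.IH Suc.prems(1) by blast
      next
        case F: False
        then have "degree A < degree B" using False Suc.prems(2) by auto
        then show ?thesis using Suc.prems(1)
          by (intro exI[of _ 0] exI[of _ 0] exI[of _ A]) (simp add: subring_0[OF SP])
      qed
    next
      case True
      let ?M = "monom (lead_coeff A) (n - degree B)"
      define A' where "A' = smult (lead_coeff B) A - ?M * B"
      have M: "?M \<in> polys_over S" using Suc.prems(1) by (intro monom_polys_over[OF S] lead)
      have A': "A' \<in> polys_over S"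
        unfolding A'_def using Suc.prems(1) B M
        by (intro subring_diff[OF SP] subring_mult[OF SP] smult_polys_over[OF S] lead)
      have "degree (?M * B) \<le> n"
        using degree_mult_le[of ?M B] degree_monom_le[of "lead_coeff A" "n - degree B"] True by linarith
      then have "degree A' \<le> n"
        unfolding A'_def using True by (intro degree_diff_le) auto
      moreover have "coeff A' n = 0"
        using True by (simp add: A'_def coeff_monom_mult)
      ultimately have "A' = 0 \<or> degree A' < n"
        by (metis coeff_0_degree_minus_1 leading_coeff_0_iff order_le_imp_less_or_eq)
      then obtain e Q R where Q: "Q \<in> polys_over S" and R: "R \<in> polys_over S"
        and eq: "smult (lead_coeff B ^ e) A' = Q * B + R" and deg: "R = 0 \<or> degree R < degree B"
        using Suc.IH A' by blast
      have "smult (lead_coeff B ^ Suc e) A = smult (lead_coeff B ^ e) (A' + ?M * B)"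
        by (simp add: A'_def mult.commute)
      also have "\<dots> = (Q + smult (lead_coeff B ^ e) ?M) * B + R"
        by (simp add: smult_add_right eq algebra_simps)
      finally have "smult (lead_coeff B ^ Suc e) A = (Q + smult (lead_coeff B ^ e) ?M) * B + R" .
      moreover have "Q + smult (lead_coeff B ^ e) ?M \<in> polys_over S"
        using Q M B by (intro subring_add[OF SP] smult_polys_over[OF S] subring_power[OF S] lead)
      ultimately show ?thesis using R deg by blast
    qed
  qed
  from this[OF A, of "Suc (degree A)"] show thesis using that by auto
qed

section \<open>The polynomial ring is completely integrally closed\<close>

text \<open>If \<open>A / B\<close> is integral of degree \<open>d\<close>, then \<open>1, \<dots>, (A / B)\<^bsup>d-1\<^esup>\<close> span all its powers, so that \<open>B\<^bsup>d-1\<^esup>\<close> is a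
common denominator of all of them.\<close>

lemma integral_imp_powers_dvd:
  fixes A B :: "'r::comm_ring_1"
  assumes eq: "A ^ d = (\<Sum>i<d. c i * A ^ i * B ^ (d - i))" and d: "d \<ge> 1"
  shows "B ^ k dvd B ^ (d - 1) * A ^ k"
proof (induction k rule: less_induct)
  case (less k)
  show ?case
  proof (cases "k < d")
    case True
    then show ?thesis by (intro dvd_mult2 le_imp_power_dvd) auto
  next
    case False
    have "A ^ k = A ^ (k - d) * A ^ d" using False by (simp flip: power_add)
    also have "\<dots> = (\<Sum>i<d. c i * (A ^ (k - d + i) * B ^ (d - i)))"
      unfolding eq by (simp add: sum_distrib_left power_add mult_ac)
    finally have "B ^ (d - 1) * A ^ k =
        (\<Sum>i<d. c i * ((B ^ (d - 1) * A ^ (k - d + i)) * B ^ (d - i)))"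
      by (simp add: sum_distrib_left mult_ac)
    also have "B ^ k dvd \<dots>"
    proof (rule dvd_sum)
      fix i assume i: "i \<in> {..<d}"
      then have "B ^ (k - d + i) dvd B ^ (d - 1) * A ^ (k - d + i)"
        using False by (intro less.IH) auto
      then have "B ^ (k - d + i) * B ^ (d - i) dvd (B ^ (d - 1) * A ^ (k - d + i)) * B ^ (d - i)"
        by (rule mult_dvd_mono) simp
      moreover have "B ^ (k - d + i) * B ^ (d - i) = B ^ k"
        using i False by (simp flip: power_add)
      ultimately have "B ^ k dvd (B ^ (d - 1) * A ^ (k - d + i)) * B ^ (d - i)" by simp
      then show "B ^ k dvd c i * ((B ^ (d - 1) * A ^ (k - d + i)) * B ^ (d - i))"
        by (rule dvd_mult)
    qed
    finally show ?thesis .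
  qed
qed

text \<open>Applied with \<open>C A + Q B\<close> a remainder of the division of \<open>A\<close> by \<open>B\<close>: the powers of \<open>(C A + Q B) / B\<close> have
the same common denominator \<open>D\<close> as those of \<open>A / B\<close>.\<close>

lemma powers_dvd_combination:
  fixes A B C D Q :: "'r::comm_ring_1"
  assumes "\<And>k. B ^ k dvd D * A ^ k"
  shows "B ^ k dvd D * (C * A + Q * B) ^ k"
proof -
  have "D * (C * A + Q * B) ^ k =
      (\<Sum>i\<le>k. of_nat (k choose i) * C ^ i * Q ^ (k - i) * ((D * A ^ i) * B ^ (k - i)))"
    by (simp add: binomial_ring sum_distrib_left power_mult_distrib mult_ac)
  also have "B ^ k dvd \<dots>"
  proof (rule dvd_sum)
    fix i assume "i \<in> {..k}"
    then have "B ^ k = B ^ i * B ^ (k - i)" by (simp flip: power_add)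
    then have "B ^ k dvd (D * A ^ i) * B ^ (k - i)"
      using mult_dvd_mono[OF assms[of i], of "B ^ (k - i)"] by simp
    then show "B ^ k dvd of_nat (k choose i) * C ^ i * Q ^ (k - i) * ((D * A ^ i) * B ^ (k - i))"
      by (rule dvd_mult)
  qed
  finally show ?thesis .
qed

text \<open>For \<open>R \<noteq> 0\<close> the degree of \<open>B\<^sup>k\<close> would grow faster with \<open>k\<close> than that of \<open>D R\<^sup>k\<close>.\<close>

lemma powers_dvd_imp_zero:
  fixes B D R :: "'r::idom poly"
  assumes dvd: "\<And>k. B ^ k dvd D * R ^ k" and D: "D \<noteq> 0" and R: "R = 0 \<or> degree R < degree B"
  shows "R = 0"
proof (rule ccontr)
  assume nz: "R \<noteq> 0"
  let ?k = "Suc (degree D)"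
  have B: "B \<noteq> 0" using nz R by auto
  have "degree (B ^ ?k) \<le> degree (D * R ^ ?k)"
    by (rule dvd_imp_degree_le[OF dvd]) (use D nz in auto)
  then have "?k * degree B \<le> degree D + ?k * degree R"
    using D nz B by (simp add: degree_mult_eq degree_power_eq del: power_Suc)
  moreover have "?k * Suc (degree R) \<le> ?k * degree B"
    using R nz by (intro mult_le_mono2) auto
  ultimately show False by simp
qed

text \<open>The substitution \<open>x\<^sub>v \<mapsto> x\<^sub>v + t\<^bsup>N v\<^esup>\<close>. For separating weights it makes a polynomial monic in \<open>t\<close> up to a
constant factor (\<open>lead_coeff_shift\<close>), so that one can divide by it, and \<open>t = 0\<close> undoes it.\<close>

definition shift :: "(nat \<Rightarrow> nat) \<Rightarrow> (nat, 'a::field) mpol \<Rightarrow> (nat, 'a) mpol poly" where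
  "shift N = meval (\<lambda>a. [:mpoly_const a:]) (\<lambda>v. [:mvar v:] + monom 1 (N v))"

lemma comm_ring_hom_const_mpoly_poly: "comm_ring_hom (\<lambda>a::'a::field. [:mpoly_const a :: (nat, 'a) mpol:])"
  by (rule comm_ring_hom_comp[OF comm_ring_hom_const_poly comm_ring_hom_mpoly_const])

lemma comm_ring_hom_shift: "comm_ring_hom (shift N)"
  unfolding shift_def by (rule comm_ring_hom_meval[OF comm_ring_hom_const_mpoly_poly])

lemma mpoly_const_eq_0_iff [simp]: "mpoly_const a = 0 \<longleftrightarrow> a = 0"
  by (metis lookup_single_eq lookup_zero mpoly_const_def single_zero)

lemma poly_shift_0:
  assumes "\<And>v. N v > 0"
  shows "poly (shift N P) 0 = P"
proof -
  have [simp]: "N v \<noteq> 0" for v using assms[of v] by simp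
  have "poly (shift N P) 0 = meval mpoly_const mvar P"
    by (simp add: shift_def hom_meval[OF comm_ring_hom_poly] poly_monom power_0_left)
  then show ?thesis by (simp add: meval_mvar)
qed

lemma shift_polys_over:
  assumes "is_subfield K" and "P \<in> mpoly_ring K V"
  shows "shift N P \<in> polys_over (mpoly_ring K V)"
  unfolding shift_def
proof (rule meval_in_subring[OF is_subring_polys_over assms(2)])
  have S: "is_subring (mpoly_ring K V)" by (rule is_subring_mpoly_ring[OF assms(1)])
  show "is_subring (mpoly_ring K V)" by fact
  show "(\<lambda>a. [:mpoly_const a:]) ` K \<subseteq> polys_over (mpoly_ring K V)"
    using assms(1) S by (auto simp: polys_over_pCons subring_0[OF is_subring_polys_over] intro: mpoly_ring_const)
  show "[:mvar v:] + monom 1 (N v) \<in> polys_over (mpoly_ring K V)" if "v \<in> V" for v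
    using assms(1) S that
    by (intro subring_add[OF is_subring_polys_over] monom_polys_over)
      (auto simp: polys_over_pCons subring_0[OF is_subring_polys_over] subring_1 intro: mpoly_ring_mvar)
qed

text \<open>The monomials of \<open>B\<close> become polynomials in \<open>t\<close> that are monic of degree their weight, and separating
weights have a single maximum.\<close>

lemma lead_coeff_shift:
  fixes B :: "(nat, 'a::field) mpol"
  assumes "B \<noteq> 0"
  obtains N b where "\<And>v. N v > 0" and "b \<noteq> 0" and "lead_coeff (shift N B) = mpoly_const b"
    and "b \<in> Poly_Mapping.lookup B ` Poly_Mapping.keys B"
proof -
  obtain N where inj: "inj_on (weight N) (Poly_Mapping.keys B)" and pos: "\<And>v. N v > 0"
    using separating_weights[of "Poly_Mapping.keys B" 1 0] by auto
  let ?X = "\<lambda>v. [:mvar v:] + monom 1 (N v) :: (nat, 'a) mpol poly"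
  have deg1: "degree (?X v) = N v" and lc1: "lead_coeff (?X v) = 1" for v
  proof -
    have less: "degree [:mvar v :: (nat, 'a) mpol:] < degree (monom (1 :: (nat, 'a) mpol) (N v))"
      using pos[of v] by (simp add: degree_monom_eq)
    show "degree (?X v) = N v"
      using degree_add_eq_right[OF less] by (simp add: degree_monom_eq)
    show "lead_coeff (?X v) = 1"
      using lead_coeff_add_le[OF less] by (simp add: degree_monom_eq)
  qed
  have nz: "?X v \<noteq> 0" for v using lc1[of v] by (metis coeff_0 zero_neq_one)
  have degm: "degree (mono_eval ?X m) = weight N m" for m
    unfolding mono_eval_def weight_def
    by (subst degree_prod_eq_sum_degree) (use nz in \<open>auto simp: degree_power_eq deg1 mult.commute\<close>)
  have lcm: "lead_coeff (mono_eval ?X m) = 1" for m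
    unfolding mono_eval_def lead_coeff_prod lead_coeff_power lc1 by simp
  define w where "w = Max (weight N ` Poly_Mapping.keys B)"
  have ne: "Poly_Mapping.keys B \<noteq> {}" using assms by simp
  then have "w \<in> weight N ` Poly_Mapping.keys B"
    unfolding w_def by (intro Max_in) auto
  then obtain m where m: "m \<in> Poly_Mapping.keys B" "w = weight N m" by auto
  have max: "weight N m' \<le> w" if "m' \<in> Poly_Mapping.keys B" for m'
    unfolding w_def using that by (intro Max_ge) auto
  have shift: "shift N B = (\<Sum>m\<in>Poly_Mapping.keys B.
      smult (mpoly_const (Poly_Mapping.lookup B m)) (mono_eval ?X m))"
    by (simp add: shift_def meval_def)
  have deg: "degree (shift N B) \<le> w"
    unfolding shift
    by (rule degree_sum_le) (use max degm in \<open>auto intro: order_trans[OF degree_smult_le]\<close>)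
  have "coeff (shift N B) w = (\<Sum>m'\<in>Poly_Mapping.keys B.
      if m' = m then mpoly_const (Poly_Mapping.lookup B m) else 0)"
    unfolding shift coeff_sum
  proof (rule sum.cong)
    fix m' assume m': "m' \<in> Poly_Mapping.keys B"
    show "coeff (smult (mpoly_const (Poly_Mapping.lookup B m')) (mono_eval ?X m')) w =
        (if m' = m then mpoly_const (Poly_Mapping.lookup B m) else 0)"
    proof (cases "m' = m")
      case True
      then show ?thesis using lcm[of m] by (simp add: degm m(2))
    next
      case False
      then have "weight N m' \<noteq> w" using inj m m' by (auto dest: inj_onD)
      then have "degree (mono_eval ?X m') < w" using max[OF m'] by (simp add: degm)
      then show ?thesis using False by (simp add: coeff_eq_0)
    qed
  qed simp
  also have "\<dots> = mpoly_const (Poly_Mapping.lookup B m)" using m by simp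
  finally have top: "coeff (shift N B) w = mpoly_const (Poly_Mapping.lookup B m)" .
  have b: "Poly_Mapping.lookup B m \<noteq> 0" using m(1) by (simp add: in_keys_iff)
  then have "degree (shift N B) = w"
    using deg top le_degree[of "shift N B" w] by (intro antisym) auto
  then show thesis using that[OF pos b] top m(1) by auto
qed

text \<open>After \<open>shift\<close> one divides \<open>A\<close> by \<open>B\<close> with remainder with respect to \<open>t\<close>. The powers of the remainder
over those of \<open>B\<close> have the common denominator \<open>D\<close>, which forces the remainder to vanish.\<close>

lemma mpoly_completely_integrally_closed:
  fixes A B D :: "(nat, 'a::field) mpol"
  assumes K: "is_subfield K" and A: "A \<in> mpoly_ring K V" and B: "B \<in> mpoly_ring K V" "B \<noteq> 0"
    and D: "D \<noteq> 0" and dvd: "\<And>k. B ^ k dvd D * A ^ k"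
  obtains Q where "Q \<in> mpoly_ring K V" and "A = B * Q"
proof -
  obtain N b where pos: "\<And>v. N v > 0" and b: "b \<noteq> 0"
    and lc: "lead_coeff (shift N B) = mpoly_const b"
    and bB: "b \<in> Poly_Mapping.lookup B ` Poly_Mapping.keys B"
    using lead_coeff_shift[OF B(2)] by blast
  interpret shift: comm_ring_hom "shift N" by (rule comm_ring_hom_shift)
  interpret const: comm_ring_hom "mpoly_const :: 'a \<Rightarrow> (nat, 'a) mpol" by (rule comm_ring_hom_mpoly_const)
  note S = is_subring_mpoly_ring[OF K, of V]
  have bK: "b \<in> K" using bB B(1) by (auto simp: mpoly_ring_def)
  have nz: "shift N P \<noteq> 0" if "P \<noteq> 0" for P
    using that poly_shift_0[of N P, OF pos] by auto
  obtain e Q R where Q: "Q \<in> polys_over (mpoly_ring K V)" and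
    eq: "smult (lead_coeff (shift N B) ^ e) (shift N A) = Q * shift N B + R"
    and R: "R = 0 \<or> degree R < degree (shift N B)"
    using pseudo_division[OF S shift_polys_over[OF K A] shift_polys_over[OF K B(1)] nz[OF B(2)]]
    by metis
  have "shift N B ^ k dvd shift N D * shift N A ^ k" for k
  proof -
    obtain C where "D * A ^ k = B ^ k * C" using dvd[of k] by (elim dvdE)
    then have "shift N (D * A ^ k) = shift N (B ^ k * C)" by simp
    then show ?thesis by (simp add: shift.hom_mult shift.hom_power)
  qed
  then have "shift N B ^ k dvd shift N D * ([:lead_coeff (shift N B) ^ e:] * shift N A + (- Q) * shift N B) ^ k" for k
    by (rule powers_dvd_combination)
  moreover have "[:lead_coeff (shift N B) ^ e:] * shift N A + (- Q) * shift N B = R"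
    using eq by simp
  ultimately have "shift N B ^ k dvd shift N D * R ^ k" for k by metis
  then have "R = 0" by (rule powers_dvd_imp_zero[OF _ nz[OF D] R])
  then have "poly (smult (lead_coeff (shift N B) ^ e) (shift N A)) 0 = poly (Q * shift N B) 0"
    using eq by simp
  then have eq0: "mpoly_const b ^ e * A = poly Q 0 * B"
    by (simp add: lc poly_shift_0[OF pos])
  define Q' where "Q' = mpoly_const (inverse b ^ e) * poly Q 0"
  have "B * Q' = mpoly_const (inverse b ^ e) * (mpoly_const b ^ e * A)"
    unfolding eq0 by (simp add: Q'_def mult_ac)
  also have "\<dots> = mpoly_const (inverse b ^ e * b ^ e) * A"
    by (simp add: const.hom_mult const.hom_power mult_ac)
  also have "\<dots> = A" using b by (simp add: const.hom_one flip: power_mult_distrib)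
  finally have "A = B * Q'" by simp
  moreover have "Q' \<in> mpoly_ring K V"
    unfolding Q'_def
  proof (intro subring_mult[OF S] poly_in_subring[OF S Q] subring_0[OF S] mpoly_ring_const[OF K])
    have "inverse b \<in> K" using K bK by (simp add: is_subfield_def)
    then show "inverse b ^ e \<in> K" by (rule subring_power[OF is_subring_subfield[OF K]])
  qed
  ultimately show thesis using that by blast
qed

section \<open>Lueroth's theorem for polynomials in one variable\<close>

lemma exists_prime_divisor:
  fixes a :: "'a::field poly"
  assumes "degree a > 0"
  obtains p where "prime_elem p" and "p dvd a"
proof -
  define P where "P = (\<lambda>n. \<exists>p. p dvd a \<and> degree p = n \<and> n > 0)"
  have "P (degree a)" unfolding P_def using assms dvd_refl[of a] by blast
  then obtain p where p: "p dvd a" "degree p > 0" and min: "\<And>n. P n \<Longrightarrow> degree p \<le> n"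
    by (metis (mono_tags, lifting) P_def LeastI Least_le)
  have "irreducible p"
  proof (rule irreducibleI)
    show nz: "p \<noteq> 0" using p(2) by auto
    show "\<not> p dvd 1" using p(2) is_unit_iff_degree[OF nz] by auto
  next
    fix b c assume bc: "p = b * c"
    have nz: "b \<noteq> 0" "c \<noteq> 0" using bc p(2) by auto
    have deg: "degree p = degree b + degree c" using nz by (simp add: bc degree_mult_eq)
    show "b dvd 1 \<or> c dvd 1"
    proof (rule ccontr)
      assume "\<not> (b dvd 1 \<or> c dvd 1)"
      then have "degree b > 0" "degree c > 0" using nz by (auto simp: is_unit_iff_degree)
      moreover have "b dvd a" using bc p(1) dvd_mult_left by blast
      ultimately have "degree p \<le> degree b" by (intro min) (auto simp: P_def)
      with deg \<open>degree c > 0\<close> show False by simp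
    qed
  qed
  then show thesis using that p(1) field_poly_irreducible_imp_prime by blast
qed

text \<open>Gauss's lemma: a prime factor of \<open>a\<close> is prime in \<open>L[t][T]\<close> and does not divide \<open>\<Phi>\<close>, so it divides the
cofactor and can be cancelled.\<close>

lemma primitive_dvd_cancel:
  fixes \<Phi> \<Psi> :: "'a::field poly poly"
  assumes prim: "\<And>p. prime_elem p \<Longrightarrow> \<not> [:p:] dvd \<Phi>"
    and "a \<noteq> 0" and "\<Phi> dvd smult a \<Psi>"
  shows "\<Phi> dvd \<Psi>"
  using assms(2,3)
proof (induction "degree a" arbitrary: a rule: less_induct)
  case less
  show ?case
  proof (cases "degree a = 0")
    case True
    then have "a dvd 1" using less.prems(1) by (simp add: is_unit_iff_degree)
    then obtain b where "1 = a * b" by (elim dvdE)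
    then have "\<Psi> = smult b (smult a \<Psi>)" by (simp add: mult.commute)
    then show ?thesis using less.prems(2) by (metis dvd_smult)
  next
    case False
    then obtain p where p: "prime_elem p" "p dvd a" using exists_prime_divisor[of a] by auto
    then obtain a' where a': "a = p * a'" by (elim dvdE)
    have nz: "p \<noteq> 0" "a' \<noteq> 0" using less.prems(1) a' by auto
    obtain X where X: "smult a \<Psi> = \<Phi> * X" using less.prems(2) by (elim dvdE)
    have "smult a \<Psi> = [:p:] * smult a' \<Psi>" by (simp add: a' mult.commute)
    then have "[:p:] dvd smult a \<Psi>" by (rule dvdI)
    then have "[:p:] dvd \<Phi> * X" unfolding X .
    then have "[:p:] dvd X"
      using lift_prime_elem_poly[OF p(1)] prim[OF p(1)] by (auto simp: prime_elem_dvd_mult_iff)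
    then obtain X' where X': "X = smult p X'" by (elim dvdE) simp
    have "smult p (smult a' \<Psi>) = smult p (\<Phi> * X')"
      using X unfolding a' X' by simp
    then have "smult p (smult a' \<Psi> - \<Phi> * X') = 0" by (simp add: smult_diff_right)
    then have "smult a' \<Psi> = \<Phi> * X'" using nz by (simp only: smult_eq_0_iff) simp
    then have "\<Phi> dvd smult a' \<Psi>" by simp
    moreover have "degree a' < degree a"
    proof -
      have "degree p > 0"
        using p(1) nz(1) is_unit_iff_degree[of p] by (auto simp: prime_elem_def)
      then show ?thesis using nz by (simp add: a' degree_mult_eq)
    qed
    ultimately show ?thesis using less.hyps nz(2) by blast
  qed
qed

text \<open>In \<open>L[t][T]\<close> the outer variable is \<open>T\<close>. Exchanging the variables makes the degree in \<open>t\<close>, and its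
additivity, available as \<^const>\<open>degree\<close>.\<close>

definition swap_vars :: "'a::field poly poly \<Rightarrow> 'a poly poly" where
  "swap_vars = peval (map_poly (\<lambda>a. [:a:])) [:[:0, 1:]:]"

lemma comm_ring_hom_swap_vars: "comm_ring_hom swap_vars"
  unfolding swap_vars_def
  by (rule comm_ring_hom_peval[OF comm_ring_hom.map_poly_hom[OF comm_ring_hom_const_poly]])

lemma coeff_swap_vars: "coeff (coeff (swap_vars \<Psi>) i) j = coeff (coeff \<Psi> j) i"
proof -
  have pow: "[:[:0, 1:]:] ^ n = [:monom (1::'a) n:]" for n
    by (induction n) (simp_all add: monom_Suc one_pCons)
  have "coeff (swap_vars \<Psi>) i = (\<Sum>n\<le>degree \<Psi>. monom (coeff (coeff \<Psi> n) i) n)"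
    unfolding swap_vars_def
    by (subst peval_altdef[OF comm_ring_hom.map_poly_hom[OF comm_ring_hom_const_poly]])
      (simp add: pow coeff_sum mult.commute coeff_map_poly smult_monom)
  then have "coeff (coeff (swap_vars \<Psi>) i) j = (\<Sum>n\<le>degree \<Psi>. if n = j then coeff (coeff \<Psi> j) i else 0)"
    by (simp add: coeff_sum cong: if_cong)
  then show ?thesis by (simp add: coeff_eq_0)
qed

text \<open>The polynomial \<open>w(T) - w(t)\<close> in \<open>L[t][T]\<close>, with outer variable \<open>T\<close>.\<close>

definition increment :: "'a::field poly \<Rightarrow> 'a poly poly" where
  "increment w = map_poly (\<lambda>a. [:a:]) w - [:w:]"

lemma poly_increment: "poly (increment w) [:0, 1:] = 0"
  by (simp add: increment_def flip: pcompose_altdef)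

lemma increment_polys_over:
  assumes "is_subring W" and "w \<in> W" and "\<And>i. [:coeff w i:] \<in> W"
  shows "increment w \<in> polys_over W"
  using assms
  by (auto simp: increment_def polys_over_def coeff_map_poly coeff_pCons
      intro!: subring_diff[OF assms(1)] subring_0[OF assms(1)] split: nat.splits)

lemma increment_lead:
  assumes "degree w \<ge> 1"
  shows "degree (increment w) = degree w" and "lead_coeff (increment w) = [:lead_coeff w:]"
proof -
  have deg: "degree (map_poly (\<lambda>a. [:a:]) w) = degree w"
    by (rule degree_map_poly) (auto simp: assms)
  then have less: "degree [:w:] < degree (map_poly (\<lambda>a. [:a:]) w)" using assms by simp
  show 1: "degree (increment w) = degree w"
    unfolding increment_def diff_conv_add_uminus
    by (subst degree_add_eq_left) (use less deg in auto)
  show "lead_coeff (increment w) = [:lead_coeff w:]"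
    unfolding 1 using assms
    by (simp add: increment_def coeff_map_poly coeff_pCons split: nat.splits)
qed

lemma swap_vars_increment: "swap_vars (increment w) = - increment w"
  by (intro poly_eqI)
    (auto simp: coeff_swap_vars increment_def coeff_map_poly coeff_pCons split: nat.splits)

lemma polys_over_quotient:
  fixes w1 w2 c :: "'a::field poly"
  assumes K: "is_subfield K" and w: "w1 \<in> polys_over K" "w2 \<in> polys_over K" "w2 \<noteq> 0" "w1 = w2 * c"
  shows "c \<in> polys_over K"
proof -
  note SK = is_subring_subfield[OF K]
  obtain e Q R where Q: "Q \<in> polys_over K"
    and eq: "smult (lead_coeff w2 ^ e) w1 = Q * w2 + R" and R: "R = 0 \<or> degree R < degree w2"
    using pseudo_division[OF SK w(1,2,3)] by metis
  let ?b = "lead_coeff w2 ^ e"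
  have b: "?b \<noteq> 0" using w(3) by simp
  have "w2 * (smult ?b c - Q) = R" using eq w(4) by (simp add: algebra_simps)
  then have "smult ?b c - Q = 0"
    using R w(3) degree_mult_right_le[of "smult ?b c - Q" w2]
    by (metis degree_mult_right_le mult.commute mult_eq_0_iff not_le)
  then have "smult (inverse ?b) Q = smult (inverse ?b) (smult ?b c)" by simp
  also have "\<dots> = smult (inverse ?b * ?b) c" by (rule smult_smult)
  also have "\<dots> = c" using b by simp
  finally have "c = smult (inverse ?b) Q" by simp
  moreover have "inverse ?b \<in> K"
    using K w(2) subring_power[OF SK] by (auto simp: is_subfield_def polys_over_def)
  ultimately show ?thesis using smult_polys_over[OF SK _ Q] by simp
qed

text \<open>The hypothesis \<open>saturated\<close> says that \<open>W\<close> is the intersection of \<open>K[t]\<close> with a field \<open>k\<close>, namely the field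
of fractions of \<open>W\<close>. As in the classical proof of Lueroth's theorem one takes the minimal polynomial
\<open>M(T)\<close> of \<open>t\<close> over \<open>k\<close>. It divides \<open>f(T) - f(t)\<close>, so by Gauss's lemma its coefficients are polynomials in
\<open>t\<close> and hence lie in \<open>W\<close>. If \<open>q\<close> is a non-constant coefficient, then \<open>M(T)\<close> divides \<open>q(T) - q(t)\<close>, and
comparison of the degrees in \<open>t\<close> shows that the two agree up to a constant. So \<open>q(T) - q(t)\<close> divides
\<open>w(T) - w(t)\<close> for every \<open>w \<in> W\<close>; at \<open>t = 0\<close> this gives \<open>w - w(0) = (q - q(0)) w'\<close> with \<open>w' \<in> W\<close> of smaller
degree.\<close>

lemma lueroth_polynomial:
  fixes W :: "'a::field poly set"
  assumes K: "is_subfield K" and W: "is_subring W" and WK: "W \<subseteq> polys_over K"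
    and const: "\<And>a. a \<in> K \<Longrightarrow> [:a:] \<in> W"
    and saturated: "\<And>w c. w \<in> W \<Longrightarrow> w \<noteq> 0 \<Longrightarrow> w * c \<in> W \<Longrightarrow> c \<in> W"
    and f: "f \<in> W" "degree f \<ge> 1"
  shows "\<exists>q\<in>W. \<forall>w\<in>W. \<exists>a\<in>polys_over K. w = pcompose a q"
proof -
  let ?t = "[:0, 1:] :: 'a poly"
  note WP = is_subring_polys_over[OF W]
  have coeff_const: "[:coeff w i:] \<in> W" if "w \<in> W" for w i
    using that WK by (intro const) (auto simp: polys_over_def)
  have inc: "increment w \<in> polys_over W" if "w \<in> W" for w
    using that coeff_const by (intro increment_polys_over[OF W]) auto
  define I where "I = {\<Psi> \<in> polys_over W. \<Psi> \<noteq> 0 \<and> poly \<Psi> ?t = 0}"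
  have "increment f \<in> I"
    using inc[OF f(1)] poly_increment[of f] increment_lead(1)[OF f(2)] f(2) by (auto simp: I_def)
  define r where "r = (LEAST n. \<exists>\<Psi>\<in>I. degree \<Psi> = n)"
  have "\<exists>\<Psi>\<in>I. degree \<Psi> = r"
    unfolding r_def by (rule LeastI_ex) (use \<open>increment f \<in> I\<close> in blast)
  then obtain \<Psi>0 where \<Psi>0: "\<Psi>0 \<in> I" "degree \<Psi>0 = r" by blast
  have r_min: "r \<le> degree \<Psi>" if "\<Psi> \<in> I" for \<Psi>
    unfolding r_def by (rule Least_le) (use that in blast)

  \<comment> \<open>Multiples of the minimal polynomial of \<open>t\<close> by rational functions of \<open>t\<close>; a leading coefficient of least degree makes \<open>\<Phi>\<close> primitive.\<close>
  define P where "P = {\<Phi>. \<exists>d. d \<noteq> 0 \<and> smult d \<Phi> \<in> I \<and> degree \<Phi> = r}"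
  have "\<Psi>0 \<in> P" unfolding P_def using \<Psi>0 by (auto intro!: exI[of _ 1])
  then obtain \<Phi> where \<Phi>: "\<Phi> \<in> P"
    and \<Phi>_min: "\<And>\<Phi>'. \<Phi>' \<in> P \<Longrightarrow> degree (lead_coeff \<Phi>) \<le> degree (lead_coeff \<Phi>')"
    using ex_has_least_nat[of "\<lambda>\<Phi>. \<Phi> \<in> P" \<Psi>0 "\<lambda>\<Phi>. degree (lead_coeff \<Phi>)"] by blast
  then obtain d where d: "d \<noteq> 0" "smult d \<Phi> \<in> I" "degree \<Phi> = r" by (auto simp: P_def)
  have \<Phi>nz: "\<Phi> \<noteq> 0" using d by (auto simp: I_def)

  have primitive: "\<not> [:p:] dvd \<Phi>" if p: "prime_elem p" for p
  proof
    assume "[:p:] dvd \<Phi>"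
    then obtain \<Phi>' where \<Phi>': "\<Phi> = smult p \<Phi>'" by (elim dvdE) simp
    have nz: "p \<noteq> 0" "lead_coeff \<Phi>' \<noteq> 0" using \<Phi>nz \<Phi>' by auto
    have "\<Phi>' \<in> P"
      unfolding P_def using d nz by (auto simp: \<Phi>' intro!: exI[of _ "d * p"])
    then have "degree (lead_coeff \<Phi>) \<le> degree (lead_coeff \<Phi>')" by (rule \<Phi>_min)
    then have "degree p = 0" using nz by (simp add: \<Phi>' degree_mult_eq)
    then show False using p nz(1) is_unit_iff_degree[of p] by (auto simp: prime_elem_def)
  qed

  have \<Phi>_dvd: "\<Phi> dvd \<Psi>" if \<Psi>: "\<Psi> \<in> polys_over W" "poly \<Psi> ?t = 0" for \<Psi>
  proof -
    let ?B = "smult d \<Phi>"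
    have B: "?B \<in> polys_over W" "?B \<noteq> 0" "poly ?B ?t = 0" using d(2) by (auto simp: I_def)
    obtain e Q R where R: "R \<in> polys_over W"
      and eq: "smult (lead_coeff ?B ^ e) \<Psi> = Q * ?B + R" and deg: "R = 0 \<or> degree R < degree ?B"
      using pseudo_division[OF W \<Psi>(1) B(1,2)] by metis
    have "poly (smult (lead_coeff ?B ^ e) \<Psi>) ?t = poly (Q * ?B + R) ?t" unfolding eq ..
    then have "poly R ?t = 0" using \<Psi>(2) B(3) by (auto simp: algebra_simps)
    then have "R = 0" using deg r_min[of R] R d(1,3) unfolding I_def by force
    then have "smult (lead_coeff ?B ^ e) \<Psi> = \<Phi> * smult d Q" using eq by (simp add: mult.commute)
    then have "\<Phi> dvd smult (lead_coeff ?B ^ e) \<Psi>" by (rule dvdI)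
    moreover have "lead_coeff ?B ^ e \<noteq> 0" using B(2) by (simp del: lead_coeff_smult)
    ultimately show ?thesis using primitive_dvd_cancel[OF primitive] by blast
  qed

  \<comment> \<open>The leading coefficient of \<open>f(T) - f(t)\<close> is constant, hence that of its divisor \<open>\<Phi>\<close> is too.\<close>
  obtain \<chi> where "increment f = \<Phi> * \<chi>"
    using \<Phi>_dvd[OF inc[OF f(1)] poly_increment] by (elim dvdE)
  then have "lead_coeff \<Phi> * lead_coeff \<chi> = [:lead_coeff f:]"
    using increment_lead(2)[OF f(2)] by (simp add: lead_coeff_mult)
  moreover have "[:lead_coeff f:] \<noteq> 0" using f(2) by auto
  ultimately have "degree (lead_coeff \<Phi>) + degree (lead_coeff \<chi>) = 0"
    by (metis degree_mult_eq degree_pCons_0 mult_zero_left mult_zero_right)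
  then obtain b where b: "lead_coeff \<Phi> = [:b:]" by (metis add_is_0 degree_eq_zeroE)
  have bnz: "b \<noteq> 0" using b \<Phi>nz by auto
  define M where "M = smult [:inverse b:] \<Phi>"
  have \<Phi>M: "\<Phi> = smult [:b:] M" using bnz by (simp add: M_def flip: one_pCons)
  have degM: "degree M = r" using d(3) bnz by (simp add: M_def)
  have leadM: "lead_coeff M = 1" using b bnz by (simp add: M_def one_pCons)
  have M_dvd: "M dvd \<Psi>" if "\<Psi> \<in> polys_over W" "poly \<Psi> ?t = 0" for \<Psi>
    using \<Phi>_dvd[OF that] unfolding \<Phi>M by (metis smult_dvd_cancel)
  have M0: "poly M ?t = 0" using d(1,2) bnz by (auto simp: I_def \<Phi>M)
  have dM: "(d * [:b:]) * coeff M i \<in> W" for i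
    using d(2) by (auto simp: I_def polys_over_def \<Phi>M)
  have dW: "d * [:b:] \<in> W" using dM[of "degree M"] leadM by simp
  have MW: "coeff M i \<in> W" for i
    by (rule saturated[OF dW _ dM]) (use d(1) bnz in auto)

  \<comment> \<open>Otherwise \<open>t\<close> would be algebraic over the constants.\<close>
  have "\<exists>i. degree (coeff M i) \<noteq> 0"
  proof (rule ccontr)
    assume *: "\<not> ?thesis"
    define m where "m = map_poly (\<lambda>c. coeff c 0) M"
    have "M = map_poly (\<lambda>a. [:a:]) m"
    proof (rule poly_eqI)
      fix n
      have "degree (coeff M n) = 0" using * by blast
      then obtain a where "coeff M n = [:a:]" by (rule degree_eq_zeroE)
      then show "coeff M n = coeff (map_poly (\<lambda>a. [:a:]) m) n"
        by (simp add: m_def coeff_map_poly)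
    qed
    with M0 have "m = 0" by (metis pcompose_altdef pcompose_idR)
    with \<open>M = map_poly (\<lambda>a. [:a:]) m\<close> leadM show False by simp
  qed
  then obtain i where i: "degree (coeff M i) \<ge> 1" by (auto simp: Suc_le_eq)
  define q where "q = coeff M i"
  have q: "q \<in> W" "degree q \<ge> 1" using MW i by (auto simp: q_def)

  obtain \<chi> where \<chi>: "increment q = M * \<chi>"
    using M_dvd[OF inc[OF q(1)] poly_increment] by (elim dvdE)
  have "\<exists>x. \<chi> = [:[:x:]:]"
  proof -
    interpret swap: comm_ring_hom swap_vars by (rule comm_ring_hom_swap_vars)
    have eq: "swap_vars M * swap_vars \<chi> = - increment q"
      unfolding swap.hom_mult[symmetric] \<chi>[symmetric] by (rule swap_vars_increment)
    have nz: "swap_vars M \<noteq> 0" "swap_vars \<chi> \<noteq> 0"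
      using eq increment_lead(1)[OF q(2)] q(2) by auto
    have "degree (swap_vars M) + degree (swap_vars \<chi>) = degree q"
      using nz eq increment_lead(1)[OF q(2)] by (metis degree_minus degree_mult_eq)
    moreover have "degree q \<le> degree (swap_vars M)"
    proof (rule le_degree)
      have "coeff (coeff (swap_vars M) (degree q)) i \<noteq> 0"
        using q(2) by (auto simp: coeff_swap_vars simp flip: q_def)
      then show "coeff (swap_vars M) (degree q) \<noteq> 0" by auto
    qed
    ultimately have deg0: "degree (swap_vars \<chi>) = 0" by simp
    have "lead_coeff (swap_vars M) * lead_coeff (swap_vars \<chi>) = - [:lead_coeff q:]"
      unfolding lead_coeff_mult[symmetric] eq lead_coeff_minus increment_lead(2)[OF q(2)] ..
    moreover have "[:lead_coeff q:] \<noteq> 0" using q(2) by auto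
    ultimately have "degree (lead_coeff (swap_vars M)) + degree (lead_coeff (swap_vars \<chi>)) = 0"
      using nz by (metis degree_mult_eq degree_minus degree_pCons_0 leading_coeff_0_iff)
    then obtain x where "lead_coeff (swap_vars \<chi>) = [:x:]" by (metis add_is_0 degree_eq_zeroE)
    with deg0 have sw: "swap_vars \<chi> = [:[:x:]:]" by (metis degree_eq_zeroE lead_coeff_pCons(2) degree_pCons_0 coeff_pCons_0)
    have "\<chi> = [:[:x:]:]"
    proof (intro poly_eqI)
      fix j k
      have "coeff (coeff \<chi> j) k = coeff (coeff (swap_vars \<chi>) k) j" by (simp add: coeff_swap_vars)
      then show "coeff (coeff \<chi> j) k = coeff (coeff [:[:x:]:] j) k"
        unfolding sw by (simp add: coeff_pCons split: nat.splits)
    qed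
    then show ?thesis ..
  qed
  then obtain x where x: "\<chi> = [:[:x:]:]" ..
  have xnz: "x \<noteq> 0" using \<chi> x increment_lead(1)[OF q(2)] q(2) by auto
  have q_dvd: "increment q dvd increment w" if w: "w \<in> W" for w
  proof -
    obtain Y where Y: "increment w = M * Y"
      using M_dvd[OF inc[OF w] poly_increment] by (elim dvdE)
    have "increment q * smult [:inverse x:] Y = increment w"
      using xnz by (simp add: \<chi> x Y mult.commute flip: one_pCons)
    then show ?thesis by (metis dvd_triv_left)
  qed

  have "\<exists>a\<in>polys_over K. w = pcompose a q" if "w \<in> W" for w
    using that
  proof (induction "degree w" arbitrary: w rule: less_induct)
    case less
    have wK: "w \<in> polys_over K" using less.prems WK by blast
    show ?case
    proof (cases "degree w = 0")
      case True
      then obtain a where "w = [:a:]" by (rule degree_eq_zeroE)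
      then show ?thesis using wK by (intro bexI[of _ w]) auto
    next
      case False
      interpret at0: comm_ring_hom "map_poly (\<lambda>c::'a poly. poly c 0)"
        by (rule comm_ring_hom.map_poly_hom[OF comm_ring_hom_poly])
      have at0: "map_poly (\<lambda>c. poly c 0) (increment v) = v - [:coeff v 0:]" for v :: "'a poly"
        by (intro poly_eqI)
          (auto simp: increment_def coeff_map_poly coeff_pCons poly_0_coeff_0 split: nat.splits)
      obtain \<Xi> where "increment w = increment q * \<Xi>" using q_dvd[OF less.prems] by (elim dvdE)
      then have "map_poly (\<lambda>c. poly c 0) (increment w) =
          map_poly (\<lambda>c. poly c 0) (increment q) * map_poly (\<lambda>c. poly c 0) \<Xi>"
        by (simp add: at0.hom_mult)
      then obtain w' where eq: "w - [:coeff w 0:] = (q - [:coeff q 0:]) * w'"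
        unfolding at0 by blast
      have degm: "degree (v - [:coeff v 0:]) = degree v" for v :: "'a poly"
      proof (cases "degree v = 0")
        case True
        then show ?thesis by (auto elim!: degree_eq_zeroE)
      next
        case False
        then show ?thesis unfolding diff_conv_add_uminus by (subst degree_add_eq_left) auto
      qed
      have "degree (q - [:coeff q 0:]) \<ge> 1" "degree (w - [:coeff w 0:]) \<ge> 1"
        using q(2) False by (auto simp: degm)
      then have nz: "q - [:coeff q 0:] \<noteq> 0" "w' \<noteq> 0" using eq by auto
      have "degree w = degree q + degree w'"
        using eq nz degm[of q] degm[of w] degree_mult_eq[OF nz] by metis
      then have less': "degree w' < degree w" using q(2) by simp
      have "w' \<in> W"
      proof (rule saturated[OF _ nz(1)])
        show "q - [:coeff q 0:] \<in> W" using q(1) by (intro subring_diff[OF W] coeff_const)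
        show "(q - [:coeff q 0:]) * w' \<in> W"
          using less.prems by (subst eq[symmetric]) (intro subring_diff[OF W] coeff_const)
      qed
      then obtain a where a: "a \<in> polys_over K" "w' = pcompose a q"
        using less.hyps[OF less'] by blast
      have "w = pcompose ([:coeff w 0:] + ([:0, 1:] - [:coeff q 0:]) * a) q"
        using eq by (simp add: pcompose_add pcompose_mult pcompose_diff pcompose_pCons pcompose_smult a(2)[symmetric] algebra_simps)
      moreover have "[:coeff w 0:] + ([:0, 1:] - [:coeff q 0:]) * a \<in> polys_over K"
      proof -
        note SK = is_subring_subfield[OF K]
        note SP = is_subring_polys_over[OF SK]
        have "coeff w 0 \<in> K" "coeff q 0 \<in> K"
          using wK q(1) WK by (auto simp: polys_over_def)
        then show ?thesis
          by (intro subring_add[OF SP] subring_mult[OF SP] subring_diff[OF SP] a(1))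
            (simp_all add: polys_over_pCons[OF SK] subring_0[OF SK] subring_1[OF SK] subring_0[OF SP])
      qed
      ultimately show ?thesis by blast
    qed
  qed
  with q(1) show ?thesis by blast
qed

section \<open>Hensel's lemma for power series\<close>

text \<open>The power series ring is complete for the \<open>s\<close>-adic topology, and the iterates of \<open>\<Phi>\<close> starting from \<open>0\<close>
stabilize coefficientwise.\<close>

lemma fps_contraction_fixpoint:
  fixes \<Phi> :: "'r::comm_ring_1 fps \<Rightarrow> 'r fps" and S :: "'r set"
  assumes S: "0 \<in> S"
    and closed: "\<And>A. A \<in> series_over S \<Longrightarrow> \<Phi> A \<in> series_over S"
    and zero: "\<And>A. fps_nth A 0 = 0 \<Longrightarrow> fps_nth (\<Phi> A) 0 = 0"
    and contract: "\<And>A B n. fps_nth A 0 = 0 \<Longrightarrow> fps_nth B 0 = 0 \<Longrightarrow>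
      fps_X ^ n dvd A - B \<Longrightarrow> fps_X ^ Suc n dvd \<Phi> A - \<Phi> B"
  obtains Z where "Z \<in> series_over S" and "fps_nth Z 0 = 0" and "\<Phi> Z = Z"
proof -
  have agree: "fps_X ^ n dvd A - B \<longleftrightarrow> (\<forall>i<n. fps_nth A i = fps_nth B i)" for A B :: "'r fps" and n
  proof
    assume "fps_X ^ n dvd A - B"
    then obtain E where E: "A - B = fps_X ^ n * E" by (elim dvdE)
    have "fps_nth A i - fps_nth B i = 0" if "i < n" for i
      using that by (simp add: E fps_X_power_mult_nth flip: fps_sub_nth)
    then show "\<forall>i<n. fps_nth A i = fps_nth B i" by simp
  next
    assume *: "\<forall>i<n. fps_nth A i = fps_nth B i"
    have "A - B = fps_X ^ n * Abs_fps (\<lambda>i. fps_nth (A - B) (i + n))"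
      by (rule fps_ext) (use * in \<open>auto simp: fps_X_power_mult_nth\<close>)
    then show "fps_X ^ n dvd A - B" by (rule dvdI)
  qed
  define z where "z = (\<lambda>k. (\<Phi> ^^ k) 0)"
  have z_Suc: "z (Suc k) = \<Phi> (z k)" for k by (simp add: z_def)
  have z0: "fps_nth (z k) 0 = 0" for k
    by (induction k) (auto simp: z_Suc zero, simp add: z_def)
  have zS: "z k \<in> series_over S" for k
    by (induction k) (auto simp: z_Suc closed, simp add: z_def series_over_def S)
  have step: "fps_X ^ k dvd z (Suc k) - z k" for k
  proof (induction k)
    case (Suc k)
    then show ?case using contract[OF z0 z0 Suc] by (simp only: z_Suc)
  qed simp
  have stable: "fps_nth (z (k + j)) i = fps_nth (z k) i" if "i < k" for k j i
  proof (induction j)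
    case (Suc j)
    have "fps_nth (z (Suc (k + j))) i = fps_nth (z (k + j)) i"
      using step[of "k + j"] that unfolding agree by simp
    with Suc show ?case by simp
  qed simp
  define Z where "Z = Abs_fps (\<lambda>i. fps_nth (z (Suc i)) i)"
  have Zz: "fps_nth Z i = fps_nth (z k) i" if "i < k" for i k
  proof -
    have "k = Suc i + (k - Suc i)" using that by simp
    then show ?thesis using stable[of i "Suc i" "k - Suc i"] by (simp add: Z_def)
  qed
  have "\<Phi> Z = Z"
  proof (rule fps_ext)
    fix n
    have "fps_X ^ Suc n dvd \<Phi> Z - \<Phi> (z n)"
      by (intro contract z0) (auto simp: agree Zz Zz[of 0 1] z0)
    then have "fps_nth (\<Phi> Z) n = fps_nth (z (Suc n)) n"
      unfolding agree by (simp add: z_Suc)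
    then show "fps_nth (\<Phi> Z) n = fps_nth Z n" by (simp add: Z_def)
  qed
  moreover have "Z \<in> series_over S" using zS by (simp add: series_over_def Z_def)
  moreover have "fps_nth Z 0 = 0" by (simp add: Z_def z0)
  ultimately show thesis using that by blast
qed

lemma poly_diff_dvd:
  fixes x y :: "'r::comm_ring_1"
  shows "x - y dvd poly p x - poly p y"
proof (induction p)
  case (pCons a p)
  have "poly (pCons a p) x - poly (pCons a p) y = (x - y) * poly p x + y * (poly p x - poly p y)"
    by (simp add: algebra_simps)
  then show ?case using pCons.IH by simp
qed simp

lemma poly_taylor2:
  fixes S :: "'r::idom set"
  assumes S: "is_subring S" and x: "x \<in> S" and P: "P \<in> polys_over S"
  obtains G where "G \<in> polys_over S"
    and "\<And>y. poly P (x + y) = poly P x + poly (pderiv P) x * y + y ^ 2 * poly G y"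
proof -
  have "\<exists>G\<in>polys_over S. \<forall>y. poly P (x + y) = poly P x + poly (pderiv P) x * y + y ^ 2 * poly G y"
    using P
  proof (induction P)
    case 0
    then show ?case by (intro bexI[of _ 0]) auto
  next
    case (pCons a P)
    then have P: "P \<in> polys_over S" by (simp add: polys_over_pCons[OF S])
    then obtain G where G: "G \<in> polys_over S"
      and eq: "\<And>y. poly P (x + y) = poly P x + poly (pderiv P) x * y + y ^ 2 * poly G y"
      using pCons.IH by blast
    note SP = is_subring_polys_over[OF S]
    let ?G = "smult x G + [:poly (pderiv P) x:] + pCons 0 G"
    have "?G \<in> polys_over S"
      using G P x
      by (intro subring_add[OF SP] smult_polys_over[OF S])
        (auto simp: polys_over_pCons[OF S] subring_0[OF S] subring_0[OF SP]
          intro!: poly_in_subring[OF S] pderiv_polys_over[OF S])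
    moreover have "poly (pCons a P) (x + y) =
        poly (pCons a P) x + poly (pderiv (pCons a P)) x * y + y ^ 2 * poly ?G y" for y
      by (simp add: eq pderiv_pCons algebra_simps power2_eq_square)
    ultimately show ?case by blast
  qed
  then show thesis using that by blast
qed

text \<open>By the Taylor expansion at \<open>A\<close> the difference \<open>B - A\<close> is annihilated by \<open>P'(A)\<close> plus a multiple of
\<open>B - A\<close>, whose constant term is that of \<open>P'(A)\<close>.\<close>

lemma simple_root_unique:
  fixes A B :: "'r::idom fps"
  assumes eq: "poly P A = poly P B" and A0: "fps_nth A 0 = fps_nth B 0"
    and simple: "fps_nth (poly (pderiv P) A) 0 \<noteq> 0"
  shows "A = B"
proof (rule ccontr)
  assume "A \<noteq> B"
  have UNIV: "is_subring (UNIV :: 'r fps set)" by (simp add: is_subring_def)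
  obtain G where G: "\<And>y. poly P (A + y) = poly P A + poly (pderiv P) A * y + y ^ 2 * poly G y"
    using poly_taylor2[OF UNIV, of A P] by (auto simp: polys_over_def)
  let ?y = "B - A"
  have "?y * (poly (pderiv P) A + ?y * poly G ?y) = 0"
    using G[of ?y] eq by (simp add: algebra_simps power2_eq_square)
  then have "poly (pderiv P) A + ?y * poly G ?y = 0" using \<open>A \<noteq> B\<close> by simp
  then have "fps_nth (poly (pderiv P) A + ?y * poly G ?y) 0 = 0" by simp
  then show False using simple A0 by simp
qed

text \<open>Hensel's lemma in Newton's form: the value \<open>c\<close> of the derivative need not be invertible, because the
perturbation of \<open>P(x)\<close> is divisible by \<open>c\<^sup>2\<close>. With \<open>\<Theta> = x + c z\<close> a factor \<open>c\<^sup>2\<close> can be cancelled from the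
Taylor expansion and \<open>z\<close> becomes the fixed point of a contraction. So no denominators arise, and
all coefficients stay in \<open>S\<close>.\<close>

lemma hensel_root:
  fixes S :: "'r::idom set" and P :: "'r fps poly"
  assumes S: "is_subring S" and P: "P \<in> polys_over (series_over S)"
    and x: "x \<in> S" and c: "c \<in> S"
    and deriv: "poly (pderiv P) (fps_const x) = fps_const c"
    and \<Delta>: "\<Delta> \<in> series_over S" "fps_nth \<Delta> 0 = 0"
  obtains \<Theta> where "\<Theta> \<in> series_over S" and "fps_nth \<Theta> 0 = x"
    and "poly P \<Theta> = poly P (fps_const x) + fps_const (c ^ 2) * \<Delta>"
proof -
  note SS = is_subring_series_over[OF S]
  have const: "fps_const a \<in> series_over S" if "a \<in> S" for a
    using that subring_0[OF S] by (auto simp: series_over_def)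
  obtain G where G: "G \<in> polys_over (series_over S)"
    and taylor: "\<And>y. poly P (fps_const x + y) =
      poly P (fps_const x) + poly (pderiv P) (fps_const x) * y + y ^ 2 * poly G y"
    using poly_taylor2[OF SS const[OF x] P] by blast
  define \<Phi> where "\<Phi> = (\<lambda>z. \<Delta> - z ^ 2 * poly G (fps_const c * z))"
  obtain z where z: "z \<in> series_over S" "fps_nth z 0 = 0" "\<Phi> z = z"
  proof (rule fps_contraction_fixpoint[of S \<Phi>])
    show "0 \<in> S" by (rule subring_0[OF S])
    show "\<Phi> A \<in> series_over S" if "A \<in> series_over S" for A
      unfolding \<Phi>_def using that
      by (intro subring_diff[OF SS] subring_mult[OF SS] subring_power[OF SS] poly_in_subring[OF SS G]
          const c \<Delta>(1))
    show "fps_nth (\<Phi> A) 0 = 0" if "fps_nth A 0 = 0" for A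
      using that \<Delta>(2) by (simp add: \<Phi>_def power2_eq_square)
    show "fps_X ^ Suc n dvd \<Phi> A - \<Phi> B"
      if A: "fps_nth A 0 = 0" and B: "fps_nth B 0 = 0" and AB: "fps_X ^ n dvd A - B" for A B n
    proof -
      let ?g = "\<lambda>z. poly G (fps_const c * z)"
      have X: "fps_X dvd C" if "fps_nth C 0 = 0" for C :: "'r fps"
      proof
        show "C = fps_X * Abs_fps (\<lambda>n. fps_nth C (Suc n))"
          by (rule fps_ext) (use that in \<open>auto simp: fps_X_mult_nth gr0_conv_Suc\<close>)
      qed
      have g: "A - B dvd ?g A - ?g B"
        using poly_diff_dvd[of "fps_const c * A" "fps_const c * B" G]
        by (metis dvd_mult_right right_diff_distrib)
      have eq: "\<Phi> A - \<Phi> B = (A - B) * (- (A + B) * ?g A) + (?g A - ?g B) * (- (B ^ 2))"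
        by (simp add: \<Phi>_def algebra_simps power2_eq_square)
      have "fps_X ^ n * fps_X dvd (A - B) * (- (A + B) * ?g A)"
        by (intro mult_dvd_mono AB dvd_mult2 X) (simp add: A B)
      moreover have "fps_X ^ n * fps_X dvd (?g A - ?g B) * (- (B ^ 2))"
        by (intro mult_dvd_mono dvd_trans[OF AB g] X) (simp add: B power2_eq_square)
      ultimately show ?thesis unfolding eq by (simp only: power_Suc2 dvd_add)
    qed
  qed blast
  have c2: "fps_const (c ^ 2) = fps_const c * fps_const c" by (simp add: power2_eq_square)
  have "poly P (fps_const x + fps_const c * z) = poly P (fps_const x) +
      fps_const (c ^ 2) * (z + z ^ 2 * poly G (fps_const c * z))"
    unfolding taylor deriv c2 by (simp only: power2_eq_square distrib_left mult_ac add_ac)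
  also have "z + z ^ 2 * poly G (fps_const c * z) = \<Delta>"
    using z(3) unfolding \<Phi>_def diff_eq_eq by (rule sym)
  finally have "poly P (fps_const x + fps_const c * z) =
      poly P (fps_const x) + fps_const (c ^ 2) * \<Delta>" .
  moreover have "fps_const x + fps_const c * z \<in> series_over S"
    using z(1) x c by (intro subring_add[OF SS] subring_mult[OF SS] const)
  moreover have "fps_nth (fps_const x + fps_const c * z) 0 = x" using z(2) by simp
  ultimately show thesis using that by blast
qed

section \<open>Linear independence over the small field\<close>

definition lin_indep :: "'a::field set \<Rightarrow> 'i set \<Rightarrow> ('i \<Rightarrow> 'a) \<Rightarrow> bool" where
  "lin_indep K I e \<longleftrightarrow> (\<forall>c. (\<forall>i\<in>I. c i \<in> K) \<longrightarrow> (\<Sum>i\<in>I. c i * e i) = 0 \<longrightarrow> (\<forall>i\<in>I. c i = 0))"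

lemma lin_indepD:
  assumes "lin_indep K I e" and "\<And>i. i \<in> I \<Longrightarrow> c i \<in> K" and "(\<Sum>i\<in>I. c i * e i) = 0" and "i \<in> I"
  shows "c i = 0"
  using assms(1)[unfolded lin_indep_def, rule_format, of c i] assms(2-4) by blast

text \<open>A linear relation over \<open>K\<close> among the \<open>e i\<close> allows one to eliminate a summand of an expansion. One starts
from the monomials of \<open>H\<close>, which are the reason for the index type.\<close>

lemma mpoly_lin_indep_expansion:
  fixes H :: "('v, 'a::field) mpol"
  assumes K: "is_subfield K" and H: "H \<in> mpoly_ring L V"
  obtains I :: "('v \<Rightarrow>\<^sub>0 nat) set" and e P where "finite I" and "lin_indep K I e"
    and "\<And>i. i \<in> I \<Longrightarrow> P i \<in> mpoly_ring K V" and "H = (\<Sum>i\<in>I. mpoly_const (e i) * P i)"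
proof -
  note SK = is_subring_subfield[OF K]
  interpret const: comm_ring_hom "mpoly_const :: 'a \<Rightarrow> ('v, 'a) mpol"
    by (rule comm_ring_hom_mpoly_const)
  have *: "\<exists>(J :: ('v \<Rightarrow>\<^sub>0 nat) set) e P. finite J \<and> lin_indep K J e \<and> (\<forall>i\<in>J. P i \<in> mpoly_ring K V) \<and>
      H = (\<Sum>i\<in>J. mpoly_const (e i) * P i)"
    if "finite I" "\<forall>i\<in>I. P i \<in> mpoly_ring K V" "H = (\<Sum>i\<in>I. mpoly_const (e i) * P i)"
    for I :: "('v \<Rightarrow>\<^sub>0 nat) set" and e P
    using that
  proof (induction I arbitrary: P rule: finite_psubset_induct)
    case (psubset I)
    show ?case
    proof (cases "lin_indep K I e")
      case True
      then show ?thesis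
        using psubset.hyps(1) psubset.prems by blast
    next
      case False
      then obtain c i0 where c: "\<And>i. i \<in> I \<Longrightarrow> c i \<in> K" "(\<Sum>i\<in>I. c i * e i) = 0"
        and i0: "i0 \<in> I" "c i0 \<noteq> 0"
        by (auto simp: lin_indep_def)
      define b where "b = (\<lambda>i. c i / c i0)"
      have bK: "b i \<in> K" if "i \<in> I" for i
        using c(1)[OF that] c(1)[OF i0(1)] K by (simp add: b_def divide_inverse is_subfield_def)
      define J where "J = I - {i0}"
      have "c i0 * e i0 + (\<Sum>i\<in>J. c i * e i) = 0"
        using c(2) sum.remove[OF psubset.hyps(1) i0(1), of "\<lambda>i. c i * e i"] by (simp add: J_def)
      moreover have "(\<Sum>i\<in>J. c i * e i) = c i0 * (\<Sum>i\<in>J. b i * e i)"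
        using i0(2) by (simp add: b_def sum_distrib_left)
      ultimately have "c i0 * (e i0 + (\<Sum>i\<in>J. b i * e i)) = 0" by (simp add: algebra_simps)
      then have e0: "e i0 = - (\<Sum>i\<in>J. b i * e i)"
        using i0(2) by (simp add: eq_neg_iff_add_eq_0)
      define P' where "P' = (\<lambda>i. P i - mpoly_const (b i) * P i0)"
      have "H = mpoly_const (e i0) * P i0 + (\<Sum>i\<in>J. mpoly_const (e i) * P i)"
        using psubset.prems(2) sum.remove[OF psubset.hyps(1) i0(1), of "\<lambda>i. mpoly_const (e i) * P i"]
        by (simp add: J_def)
      also have "\<dots> = (\<Sum>i\<in>J. mpoly_const (e i) * P' i)"
        by (simp add: e0 P'_def const.hom_uminus const.hom_sum const.hom_mult sum_distrib_left
            sum_distrib_right sum_subtractf algebra_simps)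
      finally have H': "H = (\<Sum>i\<in>J. mpoly_const (e i) * P' i)" .
      have P': "\<forall>i\<in>J. P' i \<in> mpoly_ring K V"
        unfolding P'_def J_def using psubset.prems(1) i0(1) bK
        by (auto intro!: subring_diff[OF is_subring_mpoly_ring[OF K]]
            subring_mult[OF is_subring_mpoly_ring[OF K]] mpoly_ring_const[OF K])
      have "J \<subset> I" using i0(1) by (auto simp: J_def)
      from psubset.IH[OF this P' H'] show ?thesis .
    qed
  qed
  have "H = (\<Sum>m\<in>Poly_Mapping.keys H. mpoly_const (Poly_Mapping.lookup H m) * Poly_Mapping.single m 1)"
    by (simp add: mpoly_const_def mult_single sum_single_lookup)
  moreover have "\<forall>m\<in>Poly_Mapping.keys H. Poly_Mapping.single m 1 \<in> mpoly_ring K V"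
    using H subring_1[OF SK] by (auto simp: mpoly_ring_def)
  ultimately obtain I :: "('v \<Rightarrow>\<^sub>0 nat) set" and e P where "finite I" "lin_indep K I e"
    "\<forall>i\<in>I. P i \<in> mpoly_ring K V" "H = (\<Sum>i\<in>I. mpoly_const (e i) * P i)"
    using *[of "Poly_Mapping.keys H" "\<lambda>m. Poly_Mapping.single m 1" "Poly_Mapping.lookup H"] by auto
  then show thesis by (intro that[of I e P]) auto
qed

lemma lookup_mpoly_const_mult: "Poly_Mapping.lookup (mpoly_const a * P) m = a * Poly_Mapping.lookup P m"
  unfolding mpoly_const_def mult_map_scale_conv_mult[symmetric]
  by (simp add: map.rep_eq when_def)

section \<open>Descent of a decomposition with separable outer polynomial\<close>

text \<open>The restriction of a polynomial to the curve \<open>x\<^sub>v = t\<^bsup>N v\<^esup>\<close>.\<close>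

definition curve :: "(nat \<Rightarrow> nat) \<Rightarrow> (nat, 'a::field) mpol \<Rightarrow> 'a poly" where
  "curve N = meval (\<lambda>a. [:a:]) (\<lambda>v. monom 1 (N v))"

lemma comm_ring_hom_curve: "comm_ring_hom (curve N)"
  unfolding curve_def by (rule comm_ring_hom_meval[OF comm_ring_hom_const_poly])

lemma curve_const: "curve N (mpoly_const a) = [:a:]"
  unfolding curve_def by (rule meval_const[OF comm_ring_hom_const_poly])

lemma curve_polys_over:
  assumes "is_subfield K" and "P \<in> mpoly_ring K V"
  shows "curve N P \<in> polys_over K"
  unfolding curve_def
proof (rule meval_in_subring[OF is_subring_polys_over assms(2)])
  note SK = is_subring_subfield[OF assms(1)]
  show "is_subring K" by (rule SK)
  show "(\<lambda>a. [:a:]) ` K \<subseteq> polys_over K"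
    by (auto simp: polys_over_pCons[OF SK] subring_0[OF is_subring_polys_over[OF SK]])
  show "monom 1 (N v) \<in> polys_over K" for v by (rule monom_polys_over[OF SK subring_1[OF SK]])
qed

lemma curve_compose: "curve N (mpoly_compose u H) = pcompose u (curve N H)"
  by (simp add: mpoly_compose_eq_peval pcompose_eq_peval curve_const
      hom_peval[OF comm_ring_hom_curve comm_ring_hom_mpoly_const])

abbreviation embed :: "'a::field poly \<Rightarrow> (nat, 'a) mpol poly" where
  "embed \<equiv> map_poly mpoly_const"

lemma comm_ring_hom_embed: "comm_ring_hom embed"
  by (rule comm_ring_hom.map_poly_hom[OF comm_ring_hom_mpoly_const])

lemma embed_eq_0_iff [simp]: "embed p = 0 \<longleftrightarrow> p = 0"
  by (auto simp: poly_eq_iff coeff_map_poly comm_ring_hom.hom_zero[OF comm_ring_hom_mpoly_const])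

lemma embed_polys_over:
  assumes "is_subfield K" and "p \<in> polys_over K"
  shows "embed p \<in> polys_over (mpoly_ring K V)"
  using assms
  by (auto simp: polys_over_def coeff_map_poly comm_ring_hom.hom_zero[OF comm_ring_hom_mpoly_const]
      intro: mpoly_ring_const)

text \<open>The substitution \<open>x\<^sub>v \<mapsto> t\<^bsup>N v\<^esup> + s x\<^sub>v\<close>, with outer variable \<open>s\<close> and inner variable \<open>t\<close>: the expansion of a
polynomial in directions \<open>x\<^sub>v\<close> transverse to the curve. The values \<open>s = 1\<close>, \<open>t = 0\<close> recover the
polynomial, while \<open>s = 0\<close> gives its restriction to the curve.\<close>

definition transverse :: "(nat \<Rightarrow> nat) \<Rightarrow> (nat, 'a::field) mpol \<Rightarrow> (nat, 'a) mpol poly poly" where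
  "transverse N = meval (\<lambda>a. [:[:mpoly_const a:]:]) (\<lambda>v. [:monom 1 (N v), [:mvar v:]:])"

lemma comm_ring_hom_const3:
  "comm_ring_hom (\<lambda>a::'a::field. [:[:mpoly_const a :: (nat, 'a) mpol:]:])"
  by (rule comm_ring_hom_comp[OF comm_ring_hom_const_poly comm_ring_hom_const_mpoly_poly])

lemma comm_ring_hom_transverse: "comm_ring_hom (transverse N)"
  unfolding transverse_def by (rule comm_ring_hom_meval[OF comm_ring_hom_const3])

lemma transverse_at_0: "coeff (transverse N P) 0 = embed (curve N P)"
proof -
  have "coeff (transverse N P) 0 = meval (\<lambda>a. [:mpoly_const a:]) (\<lambda>v. monom 1 (N v)) P"
    by (simp add: transverse_def hom_meval[OF comm_ring_hom_poly] flip: poly_0_coeff_0)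
  also have "\<dots> = embed (curve N P)"
    by (simp add: curve_def hom_meval[OF comm_ring_hom_embed] map_poly_monom map_poly_pCons
        comm_ring_hom.hom_zero[OF comm_ring_hom_mpoly_const]
        comm_ring_hom.hom_one[OF comm_ring_hom_mpoly_const])
  finally show ?thesis .
qed

lemma transverse_inverse:
  assumes "\<And>v. N v > 0"
  shows "poly (poly (transverse N P) 1) 0 = P"
proof -
  have [simp]: "N v \<noteq> 0" for v using assms[of v] by simp
  have "poly (poly (transverse N P) 1) 0 = meval mpoly_const mvar P"
    by (simp add: transverse_def poly_monom power_0_left
        hom_meval[OF comm_ring_hom_comp[OF comm_ring_hom_poly comm_ring_hom_poly]])
  then show ?thesis by (simp add: meval_mvar)
qed

lemma transverse_polys_over:
  assumes K: "is_subfield K" and "P \<in> mpoly_ring K V"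
  shows "transverse N P \<in> polys_over (polys_over (mpoly_ring K V))"
  unfolding transverse_def
proof (rule meval_in_subring[OF is_subring_polys_over assms(2)])
  note S = is_subring_mpoly_ring[OF K, of V]
  note SP = is_subring_polys_over[OF S]
  show "is_subring (polys_over (mpoly_ring K V))" by (rule SP)
  show "(\<lambda>a. [:[:mpoly_const a:]:]) ` K \<subseteq> polys_over (polys_over (mpoly_ring K V))"
    by (auto simp: polys_over_pCons[OF SP] polys_over_pCons[OF S] subring_0[OF SP]
        subring_0[OF is_subring_polys_over[OF SP]] intro: mpoly_ring_const[OF K])
  show "[:monom 1 (N v), [:mvar v:]:] \<in> polys_over (polys_over (mpoly_ring K V))" if "v \<in> V" for v
    using that
    by (auto simp: polys_over_pCons[OF SP] polys_over_pCons[OF S] subring_0[OF SP]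
        subring_0[OF is_subring_polys_over[OF SP]]
        intro: mpoly_ring_mvar[OF K] monom_polys_over[OF S] subring_1[OF S])
qed

text \<open>The substitution \<open>s \<mapsto> d s\<close>, followed by the inclusion of polynomials into power series.\<close>

definition rescale :: "'r::comm_ring_1 \<Rightarrow> 'r poly \<Rightarrow> 'r fps" where
  "rescale d p = Abs_fps (\<lambda>n. d ^ n * coeff p n)"

lemma comm_ring_hom_rescale: "comm_ring_hom (rescale d)"
proof
  fix p q :: "'a poly"
  show "rescale d (p + q) = rescale d p + rescale d q"
    by (rule fps_ext) (simp add: rescale_def distrib_left)
  show "rescale d (p * q) = rescale d p * rescale d q"
  proof (rule fps_ext)
    fix n
    have "d ^ n * (\<Sum>i\<le>n. coeff p i * coeff q (n - i)) =
        (\<Sum>i\<le>n. (d ^ i * coeff p i) * (d ^ (n - i) * coeff q (n - i)))"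
      unfolding sum_distrib_left
    proof (rule sum.cong)
      fix i assume "i \<in> {..n}"
      then have "d ^ n = d ^ i * d ^ (n - i)" by (simp flip: power_add)
      then show "d ^ n * (coeff p i * coeff q (n - i)) =
          (d ^ i * coeff p i) * (d ^ (n - i) * coeff q (n - i))"
        by (simp only: mult_ac)
    qed simp
    then show "fps_nth (rescale d (p * q)) n = fps_nth (rescale d p * rescale d q) n"
      by (simp add: rescale_def coeff_mult fps_mult_nth atLeast0AtMost)
  qed
  show "rescale d 1 = 1"
    by (rule fps_ext) (simp add: rescale_def coeff_1)
qed

lemma rescale_eq_0_iff:
  fixes d :: "'r::idom"
  assumes "d \<noteq> 0"
  shows "rescale d p = 0 \<longleftrightarrow> p = 0"
  using assms by (auto simp: rescale_def fps_eq_iff poly_eq_iff)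

text \<open>In this locale \<open>f\<close> is the restriction of \<open>F\<close> to the curve and \<open>c\<close> its derivative. The ring homomorphism \<open>\<iota>\<close>
embeds the polynomial ring into the power series in \<open>s\<close> by \<open>x\<^sub>v \<mapsto> t\<^bsup>N v\<^esup> + c\<^sup>2 s x\<^sub>v\<close>; the factor \<open>c\<^sup>2\<close> is what
Hensel's lemma needs in order to solve \<open>f(\<Theta>) = \<iota> F\<close> without denominators.\<close>

locale fibration =
  fixes K :: "'a::field set" and V :: "nat set" and N :: "nat \<Rightarrow> nat" and F :: "(nat, 'a) mpol"
  assumes K: "is_subfield K" and F: "F \<in> mpoly_ring K V" and N: "\<And>v. N v > 0"
    and deriv_nonzero: "pderiv (curve N F) \<noteq> 0"
begin

abbreviation "f \<equiv> curve N F"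

abbreviation "c \<equiv> embed (pderiv f)"

abbreviation "R \<equiv> polys_over (mpoly_ring K V)"

definition const :: "'a \<Rightarrow> (nat, 'a) mpol poly fps" where
  "const a = fps_const [:mpoly_const a:]"

definition \<iota> :: "(nat, 'a) mpol \<Rightarrow> (nat, 'a) mpol poly fps" where
  "\<iota> P = rescale (c ^ 2) (transverse N P)"

lemma SK: "is_subring K" and SM: "is_subring (mpoly_ring K V)" and SR: "is_subring R"
  by (simp_all add: is_subring_subfield is_subring_mpoly_ring is_subring_polys_over K)

lemma c_nonzero: "c \<noteq> 0" and c_in: "c \<in> R"
  using deriv_nonzero curve_polys_over[OF K F]
  by (auto intro!: embed_polys_over[OF K] pderiv_polys_over[OF SK])

lemma const_hom: "comm_ring_hom const"
  using comm_ring_hom_comp[OF comm_ring_hom_fps_const comm_ring_hom_const_mpoly_poly]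
  by (simp add: const_def[abs_def])

lemma const_in: "a \<in> K \<Longrightarrow> const a \<in> series_over R"
  by (auto simp: const_def series_over_def subring_0[OF SR] polys_over_pCons[OF SM]
      intro: mpoly_ring_const[OF K])

lemma \<iota>_hom: "comm_ring_hom \<iota>"
  using comm_ring_hom_comp[OF comm_ring_hom_rescale comm_ring_hom_transverse]
  by (simp add: \<iota>_def[abs_def])

lemma \<iota>_const: "\<iota> (mpoly_const a) = const a"
proof -
  have "transverse N (mpoly_const a) = [:[:mpoly_const a:]:]"
    unfolding transverse_def by (rule meval_const[OF comm_ring_hom_const3])
  then show ?thesis
    by (intro fps_ext) (simp add: \<iota>_def const_def rescale_def coeff_pCons split: nat.splits)
qed

lemma \<iota>_eq_0_iff: "\<iota> P = 0 \<longleftrightarrow> P = 0"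
proof
  assume "\<iota> P = 0"
  then have "transverse N P = 0" using c_nonzero by (simp add: \<iota>_def rescale_eq_0_iff)
  then show "P = 0" using transverse_inverse[of N P, OF N] by simp
qed (simp add: comm_ring_hom.hom_zero[OF \<iota>_hom])

lemma \<iota>_inj: "\<iota> P = \<iota> Q \<Longrightarrow> P = Q"
  using \<iota>_eq_0_iff[of "P - Q"] by (simp add: comm_ring_hom.hom_diff[OF \<iota>_hom])

lemma \<iota>_in: "P \<in> mpoly_ring K V \<Longrightarrow> \<iota> P \<in> series_over R"
  using transverse_polys_over[OF K, of P V N] c_in
  by (auto simp: \<iota>_def rescale_def series_over_def polys_over_def[of R]
      intro!: subring_mult[OF SR] subring_power[OF SR])

lemma \<iota>_nth_0: "fps_nth (\<iota> P) 0 = embed (curve N P)"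
  by (simp add: \<iota>_def rescale_def transverse_at_0)

lemma peval_const_nth_0:
  assumes "fps_nth \<Theta> 0 = [:0, 1:]"
  shows "fps_nth (peval const \<Theta> p) 0 = embed p"
proof -
  have hom: "comm_ring_hom (\<lambda>A :: (nat, 'a) mpol poly fps. fps_nth A 0)"
    by unfold_locales simp_all
  have "fps_nth (peval const \<Theta> p) 0 = peval (\<lambda>a. [:mpoly_const a:]) [:0, 1:] p"
    by (simp add: hom_peval[OF hom const_hom] assms) (simp add: const_def)
  also have "\<dots> = embed (peval (\<lambda>a. [:a:]) [:0, 1:] p)"
    by (simp add: hom_peval[OF comm_ring_hom_embed comm_ring_hom_const_poly] map_poly_pCons
        comm_ring_hom.hom_zero[OF comm_ring_hom_mpoly_const]
        comm_ring_hom.hom_one[OF comm_ring_hom_mpoly_const])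
  finally show ?thesis by (simp flip: pcompose_eq_peval)
qed

lemma pderiv_map_poly_const: "pderiv (map_poly const p) = map_poly const (pderiv p)"
proof -
  interpret const: comm_ring_hom const by (rule const_hom)
  have nat: "const (of_nat n) = of_nat n" for n
    by (induction n) (simp_all add: const.hom_zero const.hom_one const.hom_add)
  show ?thesis
    by (rule poly_eqI) (simp add: coeff_pderiv coeff_map_poly const.hom_zero const.hom_mult nat
        del: of_nat_Suc)
qed

lemma exists_root:
  obtains \<Theta> where "\<Theta> \<in> series_over R" and "fps_nth \<Theta> 0 = [:0, 1:]" and "peval const \<Theta> f = \<iota> F"
proof -
  have at_t: "peval const (fps_const [:0, 1:]) p = fps_const (embed p)" for p
  proof -
    have "peval const (fps_const [:0, 1:]) p = fps_const (peval (\<lambda>a. [:mpoly_const a:]) [:0, 1:] p)"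
      by (simp add: hom_peval[OF comm_ring_hom_fps_const comm_ring_hom_const_mpoly_poly])
        (simp add: const_def[abs_def])
    also have "peval (\<lambda>a. [:mpoly_const a:]) [:0, 1:] p = embed (peval (\<lambda>a. [:a:]) [:0, 1:] p)"
      by (simp add: hom_peval[OF comm_ring_hom_embed comm_ring_hom_const_poly] map_poly_pCons
          comm_ring_hom.hom_zero[OF comm_ring_hom_mpoly_const]
          comm_ring_hom.hom_one[OF comm_ring_hom_mpoly_const])
    finally show ?thesis by (simp flip: pcompose_eq_peval)
  qed
  \<comment> \<open>Beyond the constant term the coefficient of \<open>s\<^sup>n\<close> in \<open>\<iota> F\<close> carries the factor \<open>c\<^bsup>2n\<^esup>\<close>, so \<open>\<iota> F - f\<close> is divisible by \<open>c\<^sup>2\<close>.\<close>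
  define \<Delta> where "\<Delta> = Abs_fps (\<lambda>n. if n = 0 then 0 else (c ^ 2) ^ (n - 1) * coeff (transverse N F) n)"
  have \<iota>F: "\<iota> F = fps_const (embed f) + fps_const (c ^ 2) * \<Delta>"
  proof (rule fps_ext)
    fix n
    show "fps_nth (\<iota> F) n = fps_nth (fps_const (embed f) + fps_const (c ^ 2) * \<Delta>) n"
      by (cases n) (simp_all add: \<iota>_def rescale_def \<Delta>_def transverse_at_0 mult.assoc)
  qed
  have \<Delta>: "\<Delta> \<in> series_over R"
    using transverse_polys_over[OF K F, of N] c_in
    by (auto simp: \<Delta>_def series_over_def polys_over_def[of R] subring_0[OF SR]
        intro!: subring_mult[OF SR] subring_power[OF SR])
  have P: "map_poly const f \<in> polys_over (series_over R)"
    using curve_polys_over[OF K F, of N] const_in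
    by (auto simp: polys_over_def coeff_map_poly comm_ring_hom.hom_zero[OF const_hom])
  have t: "[:0, 1:] \<in> R"
    by (simp add: polys_over_pCons[OF SM] subring_0[OF SM] subring_1[OF SM] subring_0[OF SR])
  have d: "poly (pderiv (map_poly const f)) (fps_const [:0, 1:]) = fps_const c"
    unfolding pderiv_map_poly_const using at_t[of "pderiv f"] by (simp add: peval_def)
  obtain \<Theta> where "\<Theta> \<in> series_over R" "fps_nth \<Theta> 0 = [:0, 1:]"
    "poly (map_poly const f) \<Theta> =
      poly (map_poly const f) (fps_const [:0, 1:]) + fps_const (c ^ 2) * \<Delta>"
    using hensel_root[OF SR P t c_in d \<Delta>] by (auto simp: \<Delta>_def)
  then show thesis
    using that at_t[of f] \<iota>F by (simp add: peval_def)
qed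

text \<open>Both sides are roots of \<open>u(T) - \<iota> F\<close> that agree on the curve. The derivative of \<open>u\<close> does not vanish
there, because \<open>f' = u'(h) h'\<close> is not zero, so the two roots are equal.\<close>

lemma inner_constant_on_fibres:
  assumes \<Theta>: "fps_nth \<Theta> 0 = [:0, 1:]" "peval const \<Theta> f = \<iota> F"
    and comp: "F = mpoly_compose u H"
  shows "\<iota> H = peval const \<Theta> (curve N H)"
proof (rule simple_root_unique)
  let ?h = "curve N H"
  have fu: "f = pcompose u ?h" unfolding comp by (rule curve_compose)
  have "poly (map_poly const u) (\<iota> H) = \<iota> (mpoly_compose u H)"
    unfolding mpoly_compose_eq_peval hom_peval[OF \<iota>_hom comm_ring_hom_mpoly_const] \<iota>_const
    by (simp add: peval_def)
  also have "\<dots> = \<iota> F" by (rule arg_cong[OF comp[symmetric]])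
  also have "\<dots> = poly (map_poly const u) (peval const \<Theta> ?h)"
    unfolding \<Theta>(2)[symmetric] fu peval_peval[OF const_hom] by (simp add: peval_def)
  finally show "poly (map_poly const u) (\<iota> H) = poly (map_poly const u) (peval const \<Theta> ?h)" .
  show "fps_nth (\<iota> H) 0 = fps_nth (peval const \<Theta> ?h) 0"
    by (simp add: \<iota>_nth_0 peval_const_nth_0[OF \<Theta>(1)])
  have hom: "comm_ring_hom (\<lambda>A :: (nat, 'a) mpol poly fps. fps_nth A 0)"
    by unfold_locales simp_all
  have "pcompose (pderiv u) ?h \<noteq> 0"
    using deriv_nonzero unfolding fu pderiv_pcompose by auto
  moreover have "fps_nth (peval const (\<iota> H) (pderiv u)) 0 = embed (pcompose (pderiv u) ?h)"
    by (simp add: hom_peval[OF hom const_hom] \<iota>_nth_0 pcompose_eq_peval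
        hom_peval[OF comm_ring_hom_embed comm_ring_hom_const_poly] map_poly_pCons
        comm_ring_hom.hom_zero[OF comm_ring_hom_mpoly_const]) (simp add: const_def)
  ultimately show "fps_nth (poly (pderiv (map_poly const u)) (\<iota> H)) 0 \<noteq> 0"
    unfolding pderiv_map_poly_const by (simp add: peval_def)
qed

text \<open>The differences \<open>r i\<close> between the two sides have coefficients over \<open>K\<close> and satisfy \<open>\<Sum> e\<^sub>i r\<^sub>i = 0\<close>, so the
linear independence of the \<open>e\<^sub>i\<close> over \<open>K\<close> can be applied to each coefficient.\<close>

lemma components_constant_on_fibres:
  assumes \<Theta>: "\<Theta> \<in> series_over R" and I: "finite I" "lin_indep K I e"
    and P: "\<And>i. i \<in> I \<Longrightarrow> P i \<in> mpoly_ring K V"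
    and H: "H = (\<Sum>i\<in>I. mpoly_const (e i) * P i)"
    and \<iota>H: "\<iota> H = peval const \<Theta> (curve N H)" and i: "i \<in> I"
  shows "\<iota> (P i) = peval const \<Theta> (curve N (P i))"
proof -
  define r where "r = (\<lambda>i. \<iota> (P i) - peval const \<Theta> (curve N (P i)))"
  interpret \<iota>: comm_ring_hom \<iota> by (rule \<iota>_hom)
  interpret curve: comm_ring_hom "curve N" by (rule comm_ring_hom_curve)
  interpret ev: comm_ring_hom "peval const \<Theta>" by (rule comm_ring_hom_peval[OF const_hom])
  have r_in: "r i \<in> series_over R" if "i \<in> I" for i
  proof -
    have "peval const \<Theta> (curve N (P i)) \<in> series_over R"
      by (rule peval_in_subring[OF is_subring_series_over[OF SR] const_hom
            curve_polys_over[OF K P[OF that]] _ \<Theta>]) (auto intro: const_in)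
    then show ?thesis
      unfolding r_def by (intro subring_diff[OF is_subring_series_over[OF SR]] \<iota>_in P that)
  qed
  have ev_smult: "peval const \<Theta> (smult a p) = const a * peval const \<Theta> p" for a p
    using ev.hom_mult[of "[:a:]" p] by (simp add: peval_const[OF const_hom])
  have "(\<Sum>i\<in>I. const (e i) * r i) = 0"
    using \<iota>H unfolding H
    by (simp add: r_def \<iota>.hom_sum \<iota>.hom_mult \<iota>_const curve.hom_sum curve.hom_mult curve_const
        ev.hom_sum ev_smult right_diff_distrib sum_subtractf)
  then have sum0: "(\<Sum>i\<in>I. e i * Poly_Mapping.lookup (coeff (fps_nth (r i) n) j) m) = 0" for n j m
  proof -
    assume "(\<Sum>i\<in>I. const (e i) * r i) = 0"
    then have "Poly_Mapping.lookup (coeff (fps_nth (\<Sum>i\<in>I. const (e i) * r i) n) j) m = 0" by simp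
    then show ?thesis
      by (simp add: fps_sum_nth coeff_sum lookup_sum const_def lookup_mpoly_const_mult)
  qed
  have "Poly_Mapping.lookup (coeff (fps_nth (r i) n) j) m = 0" for n j m
  proof -
    let ?g = "\<lambda>i. Poly_Mapping.lookup (coeff (fps_nth (r i) n) j) m"
    have "\<forall>i\<in>I. ?g i \<in> K"
      using r_in by (auto simp: series_over_def polys_over_def intro: mpoly_ring_lookup[OF K])
    moreover have "(\<Sum>i\<in>I. ?g i * e i) = 0" using sum0[of n j m] by (simp add: mult.commute)
    ultimately show ?thesis using lin_indepD[OF I(2), of ?g i] i by blast
  qed
  then have "r i = 0" by (intro fps_ext poly_eqI poly_mapping_eqI) simp
  then show ?thesis by (simp add: r_def)
qed

text \<open>Here \<open>W\<close> consists of the \<open>w \<in> K[t]\<close> for which \<open>w(\<Theta>)\<close> is a fraction of polynomials over \<open>K\<close>. It contains \<open>f\<close>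
and the restriction of a non-constant component of \<open>H\<close>, whose degree is too small for Lueroth's
generator \<open>q\<close> of \<open>W\<close> to have the degree of \<open>f\<close>. The fraction \<open>q(\<Theta>)\<close> is integral, hence a polynomial \<open>Q\<close>.\<close>

lemma separable_descent:
  assumes u: "degree u \<ge> 2" and H: "H \<in> mpoly_ring L V" and comp: "F = mpoly_compose u H"
  shows "\<exists>Q\<in>mpoly_ring K V. \<exists>a\<in>polys_over K. degree a \<ge> 2 \<and> F = mpoly_compose a Q"
proof -
  obtain \<Theta> where \<Theta>: "\<Theta> \<in> series_over R" "fps_nth \<Theta> 0 = [:0, 1:]" "peval const \<Theta> f = \<iota> F"
    by (rule exists_root)
  interpret const: comm_ring_hom const by (rule const_hom)
  interpret mconst: comm_ring_hom "mpoly_const :: 'a \<Rightarrow> (nat, 'a) mpol" by (rule comm_ring_hom_mpoly_const)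
  interpret \<iota>: comm_ring_hom \<iota> by (rule \<iota>_hom)
  interpret ev: comm_ring_hom "peval const \<Theta>" by (rule comm_ring_hom_peval[OF const_hom])
  have ev_nz: "peval const \<Theta> w \<noteq> 0" if "w \<noteq> 0" for w
    using that peval_const_nth_0[OF \<Theta>(2), of w] by auto

  define W where "W = {w \<in> polys_over K. \<exists>A\<in>mpoly_ring K V. \<exists>B\<in>mpoly_ring K V.
    B \<noteq> 0 \<and> peval const \<Theta> w * \<iota> B = \<iota> A}"
  have WI: "w \<in> W" if "w \<in> polys_over K" "A \<in> mpoly_ring K V" "B \<in> mpoly_ring K V" "B \<noteq> 0"
    "peval const \<Theta> w * \<iota> B = \<iota> A" for w A B
    using that by (auto simp: W_def)
  have WE: "\<exists>A B. w \<in> polys_over K \<and> A \<in> mpoly_ring K V \<and> B \<in> mpoly_ring K V \<and> B \<noteq> 0 \<and>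
    peval const \<Theta> w * \<iota> B = \<iota> A" if "w \<in> W" for w
    using that by (auto simp: W_def)
  note SP = is_subring_polys_over[OF SK]
  have W_const: "[:a:] \<in> W" if "a \<in> K" for a
    by (rule WI[of _ "mpoly_const a" 1])
      (use that in \<open>auto simp: polys_over_pCons[OF SK] subring_0[OF SP] subring_1[OF SM] \<iota>_const
        \<iota>.hom_one peval_const[OF const_hom] intro: mpoly_ring_const[OF K]\<close>)
  have W_in: "curve N P \<in> W" if "P \<in> mpoly_ring K V" "\<iota> P = peval const \<Theta> (curve N P)" for P
    by (rule WI[of _ P 1])
      (use that in \<open>auto simp: subring_1[OF SM] \<iota>.hom_one intro: curve_polys_over[OF K]\<close>)
  have W: "is_subring W"
    unfolding is_subring_def
  proof (intro conjI ballI)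
    show "1 \<in> W" using W_const[OF subring_1[OF SK]] by (simp add: one_pCons)
    show "- 1 \<in> W" using W_const[OF subring_uminus[OF SK subring_1[OF SK]]] by (simp add: one_pCons)
  next
    fix v w assume "v \<in> W" and "w \<in> W"
    then obtain A1 B1 A2 B2 where
      1: "v \<in> polys_over K" "A1 \<in> mpoly_ring K V" "B1 \<in> mpoly_ring K V" "B1 \<noteq> 0" "peval const \<Theta> v * \<iota> B1 = \<iota> A1"
      and 2: "w \<in> polys_over K" "A2 \<in> mpoly_ring K V" "B2 \<in> mpoly_ring K V" "B2 \<noteq> 0" "peval const \<Theta> w * \<iota> B2 = \<iota> A2"
      using WE[of v] WE[of w] by blast
    show "v + w \<in> W"
    proof (rule WI[of _ "A1 * B2 + A2 * B1" "B1 * B2"])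
      show "peval const \<Theta> (v + w) * \<iota> (B1 * B2) = \<iota> (A1 * B2 + A2 * B1)"
        by (simp add: ev.hom_add \<iota>.hom_add \<iota>.hom_mult 1(5)[symmetric] 2(5)[symmetric] algebra_simps)
    qed (use 1 2 in \<open>auto intro: subring_add[OF SP] subring_add[OF SM] subring_mult[OF SM]\<close>)
    show "v * w \<in> W"
    proof (rule WI[of _ "A1 * A2" "B1 * B2"])
      show "peval const \<Theta> (v * w) * \<iota> (B1 * B2) = \<iota> (A1 * A2)"
        by (simp add: ev.hom_mult \<iota>.hom_mult 1(5)[symmetric] 2(5)[symmetric] algebra_simps)
    qed (use 1 2 in \<open>auto intro: subring_mult[OF SP] subring_mult[OF SM]\<close>)
  qed
  have saturated: "v \<in> W" if w: "w \<in> W" "w \<noteq> 0" and wv: "w * v \<in> W" for w v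
  proof -
    obtain A1 B1 A2 B2 where
      1: "w * v \<in> polys_over K" "A1 \<in> mpoly_ring K V" "B1 \<in> mpoly_ring K V" "B1 \<noteq> 0"
        "peval const \<Theta> (w * v) * \<iota> B1 = \<iota> A1"
      and 2: "w \<in> polys_over K" "A2 \<in> mpoly_ring K V" "B2 \<in> mpoly_ring K V" "B2 \<noteq> 0"
        "peval const \<Theta> w * \<iota> B2 = \<iota> A2"
      using WE[OF wv] WE[OF w(1)] by blast
    have "\<iota> A2 \<noteq> 0" unfolding 2(5)[symmetric] using ev_nz[OF w(2)] 2(4) by (simp add: \<iota>_eq_0_iff)
    then have A2: "A2 \<noteq> 0" by (simp add: \<iota>_eq_0_iff)
    show ?thesis
    proof (rule WI[of _ "A1 * B2" "A2 * B1"])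
      show "v \<in> polys_over K" by (rule polys_over_quotient[OF K 1(1) 2(1) w(2) refl])
      show "peval const \<Theta> v * \<iota> (A2 * B1) = \<iota> (A1 * B2)"
        by (simp add: ev.hom_mult \<iota>.hom_mult 1(5)[symmetric] 2(5)[symmetric] mult_ac)
    qed (use 1 2 A2 in \<open>auto intro: subring_mult[OF SM]\<close>)
  qed

  define h where "h = curve N H"
  have fu: "f = pcompose u h" unfolding h_def comp by (rule curve_compose)
  have "degree f \<noteq> 0"
  proof
    assume "degree f = 0"
    then obtain b where "f = [:b:]" by (rule degree_eq_zeroE)
    with deriv_nonzero show False by (simp add: pderiv_pCons)
  qed
  then have h: "degree h \<ge> 1" and f_deg: "degree h < degree f"
    using u by (auto simp: fu degree_pcompose Suc_le_eq)

  obtain I :: "(nat \<Rightarrow>\<^sub>0 nat) set" and e P where I: "finite I" "lin_indep K I e"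
    and P: "\<And>i. i \<in> I \<Longrightarrow> P i \<in> mpoly_ring K V" and HP: "H = (\<Sum>i\<in>I. mpoly_const (e i) * P i)"
    using mpoly_lin_indep_expansion[OF K H] by blast
  interpret curve: comm_ring_hom "curve N" by (rule comm_ring_hom_curve)
  have hP: "h = (\<Sum>i\<in>I. smult (e i) (curve N (P i)))"
    by (simp add: h_def HP curve.hom_sum curve.hom_mult curve_const)
  have P_deg: "degree (curve N (P i)) \<le> degree h" if i: "i \<in> I" for i
  proof (rule degree_le, intro allI impI)
    fix j assume j: "degree h < j"
    have "(\<Sum>i\<in>I. coeff (curve N (P i)) j * e i) = coeff h j"
      by (simp add: hP coeff_sum mult.commute)
    also have "\<dots> = 0" using j by (rule coeff_eq_0)
    finally have "(\<Sum>i\<in>I. coeff (curve N (P i)) j * e i) = 0" .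
    moreover have "\<forall>i\<in>I. coeff (curve N (P i)) j \<in> K"
      using curve_polys_over[OF K P] by (auto simp: polys_over_def)
    ultimately show "coeff (curve N (P i)) j = 0"
      using lin_indepD[OF I(2), of "\<lambda>i. coeff (curve N (P i)) j" i] i by blast
  qed
  have "\<exists>i\<in>I. degree (curve N (P i)) \<noteq> 0"
  proof (rule ccontr)
    assume "\<not> ?thesis"
    then have "degree h \<le> 0"
      unfolding hP by (intro degree_sum_le I(1)) (auto intro: order_trans[OF degree_smult_le])
    with h show False by simp
  qed
  then obtain i where i: "i \<in> I" "degree (curve N (P i)) \<ge> 1" by (auto simp: Suc_le_eq)
  define p where "p = curve N (P i)"
  have p: "degree p \<ge> 1" "degree p < degree f" using i(2) P_deg[OF i(1)] f_deg by (auto simp: p_def)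
  have pW: "p \<in> W"
    unfolding p_def
    by (intro W_in P i(1) components_constant_on_fibres[OF \<Theta>(1) I P HP _ i(1)]
        inner_constant_on_fibres[OF \<Theta>(2,3) comp])
  have fW: "f \<in> W" by (intro W_in F \<Theta>(3)[symmetric])

  have WK: "W \<subseteq> polys_over K" by (auto simp: W_def)
  have f1: "degree f \<ge> 1" using f_deg by simp
  have "\<exists>q\<in>W. \<forall>w\<in>W. \<exists>a\<in>polys_over K. w = pcompose a q"
    by (rule lueroth_polynomial[OF K W WK W_const saturated fW f1])
  then obtain q where q: "q \<in> W" and gen: "\<And>w. w \<in> W \<Longrightarrow> \<exists>a\<in>polys_over K. w = pcompose a q"
    by (elim bexE) (erule that, erule (1) bspec)
  obtain a where a: "a \<in> polys_over K" "f = pcompose a q" using gen[OF fW] by blast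
  obtain b where b: "p = pcompose b q" using gen[OF pW] by blast
  have "degree q \<le> degree p" using p(1) unfolding b degree_pcompose by (cases "degree b") auto
  then have "degree q < degree a * degree q" using p(2) unfolding a(2) degree_pcompose by linarith
  then have d: "degree a \<ge> 2" by (cases "degree a" rule: nat.exhaust) (auto simp: Suc_le_eq intro: gr0I)
  let ?d = "degree a"

  obtain A B where A: "A \<in> mpoly_ring K V" and B: "B \<in> mpoly_ring K V" "B \<noteq> 0"
    and q_frac: "peval const \<Theta> q * \<iota> B = \<iota> A"
    using WE[OF q] by blast
  have F_q: "\<iota> F = (\<Sum>i\<le>?d. const (coeff a i) * peval const \<Theta> q ^ i)"
    unfolding \<Theta>(3)[symmetric] a(2) peval_peval[OF const_hom] by (rule peval_altdef[OF const_hom])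
  have "\<iota> (F * B ^ ?d) = (\<Sum>i\<le>?d. const (coeff a i) * (peval const \<Theta> q ^ i * \<iota> B ^ ?d))"
    by (simp add: \<iota>.hom_mult \<iota>.hom_power F_q sum_distrib_right mult.assoc)
  also have "\<dots> = (\<Sum>i\<le>?d. \<iota> (mpoly_const (coeff a i) * A ^ i * B ^ (?d - i)))"
  proof (rule sum.cong)
    fix i assume "i \<in> {..?d}"
    then have "\<iota> B ^ ?d = \<iota> B ^ i * \<iota> B ^ (?d - i)" by (simp flip: power_add)
    then have "peval const \<Theta> q ^ i * \<iota> B ^ ?d = \<iota> A ^ i * \<iota> B ^ (?d - i)"
      by (simp add: power_mult_distrib mult.assoc flip: q_frac)
    then show "const (coeff a i) * (peval const \<Theta> q ^ i * \<iota> B ^ ?d) =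
        \<iota> (mpoly_const (coeff a i) * A ^ i * B ^ (?d - i))"
      by (simp add: \<iota>.hom_mult \<iota>.hom_power \<iota>_const mult.assoc)
  qed simp
  finally have "F * B ^ ?d = (\<Sum>i\<le>?d. mpoly_const (coeff a i) * A ^ i * B ^ (?d - i))"
    unfolding \<iota>.hom_sum[symmetric] by (rule \<iota>_inj)
  then have rel: "mpoly_const (lead_coeff a) * A ^ ?d =
      F * B ^ ?d - (\<Sum>i<?d. mpoly_const (coeff a i) * A ^ i * B ^ (?d - i))"
    by (simp add: lessThan_Suc_atMost[symmetric] del: lessThan_Suc_atMost)
  define l :: "(nat, 'a) mpol" where "l = mpoly_const (inverse (lead_coeff a))"
  have l: "l * mpoly_const (lead_coeff a) = 1"
  proof -
    have "lead_coeff a \<noteq> 0" using d by auto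
    then show ?thesis by (simp add: l_def mconst.hom_one flip: mconst.hom_mult)
  qed
  \<comment> \<open>The equation of integral dependence of \<open>A / B\<close>: the coefficients of \<open>a(T) - F\<close> divided by the leading one.\<close>
  define C where "C = (\<lambda>i. l * ((if i = 0 then F else 0) - mpoly_const (coeff a i)))"
  have "A ^ ?d = l * (mpoly_const (lead_coeff a) * A ^ ?d)"
    using l by (simp flip: mult.assoc)
  also have "\<dots> = (\<Sum>i<?d. C i * A ^ i * B ^ (?d - i))"
  proof -
    have "(\<Sum>i<?d. (if i = 0 then F else 0) * A ^ i * B ^ (?d - i)) =
        (\<Sum>i<?d. if i = 0 then F * B ^ ?d else 0)"
      by (rule sum.cong) auto
    also have "\<dots> = F * B ^ ?d" using d by simp
    finally have FB: "(\<Sum>i<?d. (if i = 0 then F else 0) * A ^ i * B ^ (?d - i)) = F * B ^ ?d" .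
    have "(\<Sum>i<?d. C i * A ^ i * B ^ (?d - i)) =
        l * (\<Sum>i<?d. (if i = 0 then F else 0) * A ^ i * B ^ (?d - i)) -
        l * (\<Sum>i<?d. mpoly_const (coeff a i) * A ^ i * B ^ (?d - i))"
      by (simp add: C_def sum_distrib_left sum_subtractf algebra_simps)
    then show ?thesis unfolding rel FB by (simp add: right_diff_distrib)
  qed
  finally have integral: "A ^ ?d = (\<Sum>i<?d. C i * A ^ i * B ^ (?d - i))" .
  have "B ^ k dvd B ^ (?d - 1) * A ^ k" for k
    by (rule integral_imp_powers_dvd[OF integral]) (use d in simp)
  then obtain Q where Q: "Q \<in> mpoly_ring K V" "A = B * Q"
    using mpoly_completely_integrally_closed[OF K A B, of "B ^ (?d - 1)"] B(2) by auto
  have "peval const \<Theta> q * \<iota> B = \<iota> Q * \<iota> B"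
    unfolding q_frac Q(2) \<iota>.hom_mult by (rule mult.commute)
  then have "peval const \<Theta> q = \<iota> Q" using B(2) by (simp add: \<iota>_eq_0_iff)
  then have "\<iota> F = peval const (\<iota> Q) a"
    unfolding \<Theta>(3)[symmetric] a(2) peval_peval[OF const_hom] by simp
  also have "\<dots> = \<iota> (mpoly_compose a Q)"
    unfolding mpoly_compose_eq_peval hom_peval[OF \<iota>_hom comm_ring_hom_mpoly_const] \<iota>_const ..
  finally have "F = mpoly_compose a Q" by (rule \<iota>_inj)
  then show ?thesis using Q(1) a(1) d by blast
qed

end

section \<open>Descent in positive characteristic\<close>

lemma curve_altdef:
  "curve N P = (\<Sum>m\<in>Poly_Mapping.keys P. monom (Poly_Mapping.lookup P m) (weight N m))"
  by (simp add: curve_def meval_def mono_eval_monom smult_monom)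

text \<open>The weights are chosen such that modulo the characteristic the weight of \<open>m\<close> is its exponent at \<open>j\<close>,
and such that no other monomial of \<open>P\<close> contributes to the same power of \<open>t\<close>.\<close>

lemma pderiv_curve_nonzero:
  fixes P :: "(nat, 'a::field) mpol"
  assumes m: "m \<in> Poly_Mapping.keys P" and j: "of_nat (Poly_Mapping.lookup m j) \<noteq> (0::'a)"
  obtains N where "\<And>v. N v > 0" and "pderiv (curve N P) \<noteq> 0"
proof -
  \<comment> \<open>In characteristic zero any positive weight will do, so the divisibility condition is made void.\<close>
  define p where "p = (if CHAR('a) = 0 then 1 else CHAR('a))"
  have p0: "p > 0" by (simp add: p_def)
  obtain N where inj: "inj_on (weight N) (Poly_Mapping.keys P)" and Nj: "N j = 1"
    and dvd: "\<forall>i. i \<noteq> j \<longrightarrow> p dvd N i" and pos: "\<forall>i. N i > 0"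
    by (rule separating_weights[OF finite_keys[of P] p0])
  define w where "w = weight N m"
  have jm: "j \<in> Poly_Mapping.keys m" using j by (cases "Poly_Mapping.lookup m j = 0") (auto simp: in_keys_iff)
  have w: "w = Poly_Mapping.lookup m j + (\<Sum>v\<in>Poly_Mapping.keys m - {j}. N v * Poly_Mapping.lookup m v)"
    using sum.remove[OF finite_keys jm, of "\<lambda>v. N v * Poly_Mapping.lookup m v"]
    by (simp add: w_def weight_def Nj)
  have w_nz: "of_nat w \<noteq> (0::'a)"
  proof (cases "CHAR('a) = 0")
    case True
    have "w > 0" unfolding w using jm by (simp add: in_keys_iff)
    then show ?thesis using True by (simp add: of_nat_eq_0_iff_char_dvd)
  next
    case False
    have "p dvd (\<Sum>v\<in>Poly_Mapping.keys m - {j}. N v * Poly_Mapping.lookup m v)"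
      using dvd by (intro dvd_sum dvd_mult2) auto
    then have "(of_nat (\<Sum>v\<in>Poly_Mapping.keys m - {j}. N v * Poly_Mapping.lookup m v) :: 'a) = 0"
      using False by (simp only: of_nat_eq_0_iff_char_dvd p_def if_False)
    then show ?thesis using j unfolding w of_nat_add by simp
  qed
  have "coeff (curve N P) w =
      (\<Sum>m'\<in>Poly_Mapping.keys P. if m' = m then Poly_Mapping.lookup P m else 0)"
    unfolding curve_altdef coeff_sum coeff_monom
    by (rule sum.cong) (use inj m in \<open>auto simp: w_def dest: inj_onD\<close>)
  also have "\<dots> = Poly_Mapping.lookup P m" using m by simp
  finally have "coeff (curve N P) w \<noteq> 0" using m by (simp add: in_keys_iff)
  moreover have "w > 0" using w_nz by (cases w) auto
  ultimately have "coeff (pderiv (curve N P)) (w - 1) \<noteq> 0"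
    using w_nz by (simp add: coeff_pderiv del: of_nat_Suc)
  then have "pderiv (curve N P) \<noteq> 0" by auto
  with pos show thesis by (intro that[of N]) auto
qed

lemma pderiv_curve_zero:
  fixes P :: "(nat, 'a::field) mpol"
  assumes "\<And>m j. m \<in> Poly_Mapping.keys P \<Longrightarrow> of_nat (Poly_Mapping.lookup m j) = (0::'a)"
  shows "pderiv (curve N P) = 0"
proof -
  have "of_nat (weight N m) = (0::'a)" if "m \<in> Poly_Mapping.keys P" for m
    using assms[OF that] by (simp add: weight_def)
  then have "\<forall>m\<in>Poly_Mapping.keys P. pderiv (monom (Poly_Mapping.lookup P m) (weight N m)) = 0"
    by (simp add: pderiv_monom)
  note terms = this
  have zero: "pderiv (\<Sum>m\<in>A. g m) = 0" if "\<forall>m\<in>A. pderiv (g m) = 0" for A and g :: "_ \<Rightarrow> 'a poly"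
    using that by (induction A rule: infinite_finite_induct) (simp_all add: pderiv_add)
  show ?thesis unfolding curve_altdef by (rule zero[OF terms])
qed

text \<open>The exponent vector of the \<open>p\<close>-th power of a monomial.\<close>

definition scale :: "nat \<Rightarrow> (nat \<Rightarrow>\<^sub>0 nat) \<Rightarrow> (nat \<Rightarrow>\<^sub>0 nat)" where
  "scale p = Poly_Mapping.map (\<lambda>n. p * n)"

lemma lookup_scale: "Poly_Mapping.lookup (scale p m) v = p * Poly_Mapping.lookup m v"
  by (simp add: scale_def map.rep_eq when_def)

lemma scale_eq_iff [simp]: "p > 0 \<Longrightarrow> scale p m = scale p m' \<longleftrightarrow> m = m'"
  by (auto simp: poly_mapping_eq_iff fun_eq_iff lookup_scale)

lemma single_power: "Poly_Mapping.single m (a::'a::field) ^ n = Poly_Mapping.single (scale n m) (a ^ n)"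
proof (induction n)
  case 0
  have "scale 0 m = 0" by (rule poly_mapping_eqI) (simp add: lookup_scale)
  then show ?case by simp
next
  case (Suc n)
  have "m + scale n m = scale (Suc n) m"
    by (rule poly_mapping_eqI) (simp add: lookup_scale lookup_add)
  with Suc show ?case by (simp add: mult_single)
qed

definition var_power :: "nat \<Rightarrow> (nat, 'a::field) mpol \<Rightarrow> (nat, 'a) mpol" where
  "var_power p = meval mpoly_const (\<lambda>v. mvar v ^ p)"

lemma comm_ring_hom_var_power: "comm_ring_hom (var_power p)"
  unfolding var_power_def by (rule comm_ring_hom_meval[OF comm_ring_hom_mpoly_const])

lemma var_power_const: "var_power p (mpoly_const a) = mpoly_const a"
  unfolding var_power_def by (rule meval_const[OF comm_ring_hom_mpoly_const])

lemma var_power_single: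
  "var_power p (Poly_Mapping.single m (a::'a::field)) = Poly_Mapping.single (scale p m) a"
proof -
  have "mono_eval (\<lambda>v. mvar v ^ p :: (nat, 'a) mpol) m = mono_eval mvar m ^ p"
    by (simp add: mono_eval_def prod_power_distrib power_commutes flip: power_mult mult.commute)
  then show ?thesis
    by (simp add: var_power_def meval_single[OF comm_ring_hom_mpoly_const] mono_eval_mvar single_power
        mpoly_const_def mult_single)
qed

lemma var_power_altdef:
  "var_power p P = (\<Sum>m\<in>Poly_Mapping.keys P. Poly_Mapping.single (scale p m) (Poly_Mapping.lookup P m))"
proof -
  have "var_power p P = var_power p (\<Sum>m\<in>Poly_Mapping.keys P. Poly_Mapping.single m (Poly_Mapping.lookup P m))"
    by (simp add: sum_single_lookup)
  then show ?thesis by (simp add: comm_ring_hom.hom_sum[OF comm_ring_hom_var_power] var_power_single)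
qed

lemma lookup_var_power:
  assumes "p > 0"
  shows "Poly_Mapping.lookup (var_power p P) (scale p m) = Poly_Mapping.lookup P m"
  using assms by (simp add: var_power_altdef lookup_sum lookup_single when_def in_keys_iff)

lemma var_power_inj: "p > 0 \<Longrightarrow> var_power p P = var_power p Q \<Longrightarrow> P = Q"
  by (metis lookup_var_power poly_mapping_eqI)

lemma var_power_mpoly_ring:
  assumes "is_subfield K" and "P \<in> mpoly_ring K V"
  shows "var_power p P \<in> mpoly_ring K V"
  unfolding var_power_def
  by (rule meval_in_subring[OF is_subring_mpoly_ring[OF assms(1)] assms(2)])
    (auto intro: mpoly_ring_const mpoly_ring_mvar subring_power[OF is_subring_mpoly_ring] assms(1))

lemma var_power_compose: "var_power p (mpoly_compose u H) = mpoly_compose u (var_power p H)"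
  by (simp add: mpoly_compose_eq_peval var_power_const
      hom_peval[OF comm_ring_hom_var_power comm_ring_hom_mpoly_const])

lemma var_power_preimage:
  assumes K: "is_subfield K" and F: "F \<in> mpoly_ring K V"
    and dvd: "\<And>m j. m \<in> Poly_Mapping.keys F \<Longrightarrow> p dvd Poly_Mapping.lookup m j"
  obtains P where "P \<in> mpoly_ring K V" and "F = var_power p P"
proof -
  define root :: "(nat \<Rightarrow>\<^sub>0 nat) \<Rightarrow> (nat \<Rightarrow>\<^sub>0 nat)" where "root = Poly_Mapping.map (\<lambda>n. n div p)"
  have lookup_root: "Poly_Mapping.lookup (root m) v = Poly_Mapping.lookup m v div p" for m :: "nat \<Rightarrow>\<^sub>0 nat" and v
    by (simp add: root_def map.rep_eq when_def)
  have scale_root: "scale p (root m) = m" if "m \<in> Poly_Mapping.keys F" for m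
    using dvd[OF that] by (intro poly_mapping_eqI) (simp add: lookup_scale lookup_root)
  define P where "P = (\<Sum>m\<in>Poly_Mapping.keys F. Poly_Mapping.single (root m) (Poly_Mapping.lookup F m))"
  have "var_power p P = (\<Sum>m\<in>Poly_Mapping.keys F. Poly_Mapping.single m (Poly_Mapping.lookup F m))"
    unfolding P_def comm_ring_hom.hom_sum[OF comm_ring_hom_var_power] var_power_single
    by (rule sum.cong) (simp_all add: scale_root)
  then have "F = var_power p P" by (simp add: sum_single_lookup)
  moreover have "P \<in> mpoly_ring K V"
    unfolding P_def
  proof (rule subring_sum[OF is_subring_mpoly_ring[OF K]])
    fix m assume m: "m \<in> Poly_Mapping.keys F"
    have "Poly_Mapping.keys (root m) \<subseteq> Poly_Mapping.keys m"
      by (rule subsetI) (metis div_0 in_keys_iff lookup_root)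
    then show "Poly_Mapping.single (root m) (Poly_Mapping.lookup F m) \<in> mpoly_ring K V"
      using F m by (fastforce simp: mpoly_ring_def)
  qed
  ultimately show thesis using that by blast
qed

lemma CHAR_mpoly: "CHAR((nat, 'a::field) mpol) = CHAR('a)"
proof (rule CHAR_eqI)
  show "of_nat CHAR('a) = (0 :: (nat, 'a) mpol)"
    by (simp flip: single_of_nat)
  fix n assume "of_nat n = (0 :: (nat, 'a) mpol)"
  then have "Poly_Mapping.lookup (of_nat n :: (nat, 'a) mpol) 0 = 0" by simp
  then have "of_nat n = (0::'a)" by (simp add: lookup_of_nat)
  then show "CHAR('a) dvd n" by (simp add: of_nat_eq_0_iff_char_dvd)
qed

text \<open>In characteristic \<open>p\<close> raising to the \<open>p\<close>-th power splits into this map on the coefficients and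
\<^const>\<open>var_power\<close> on the monomials (\<open>power_CHAR_mpoly\<close>).\<close>

definition frob :: "nat \<Rightarrow> (nat, 'a::field) mpol \<Rightarrow> (nat, 'a) mpol" where
  "frob p = Poly_Mapping.map (\<lambda>a. a ^ p)"

lemma lookup_frob: "p > 0 \<Longrightarrow> Poly_Mapping.lookup (frob p H) m = Poly_Mapping.lookup H m ^ p"
  by (simp add: frob_def map.rep_eq when_def)

lemma keys_frob: "p > 0 \<Longrightarrow> Poly_Mapping.keys (frob p H) = Poly_Mapping.keys H"
  by (auto simp: in_keys_iff lookup_frob)

lemma frob_mpoly_ring: "is_subfield K \<Longrightarrow> p > 0 \<Longrightarrow> H \<in> mpoly_ring K V \<Longrightarrow> frob p H \<in> mpoly_ring K V"
  by (auto simp: mpoly_ring_def keys_frob lookup_frob intro: subring_power[OF is_subring_subfield])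

lemma power_CHAR_mpoly:
  fixes H :: "(nat, 'a::field) mpol"
  assumes p: "p = CHAR('a)" "p > 0"
  shows "H ^ p = var_power p (frob p H)"
proof -
  have "prime CHAR('a)" using p prime_CHAR_semidom by blast
  then have "(\<Sum>m\<in>Poly_Mapping.keys H. Poly_Mapping.single m (Poly_Mapping.lookup H m)) ^ p =
      (\<Sum>m\<in>Poly_Mapping.keys H. Poly_Mapping.single m (Poly_Mapping.lookup H m) ^ p)"
    by (intro freshmans_dream_sum) (simp_all add: CHAR_mpoly p(1))
  then show ?thesis
    using p(2) by (simp add: sum_single_lookup var_power_altdef single_power keys_frob lookup_frob)
qed

lemma lookup_power_CHAR:
  fixes H :: "(nat, 'a::field) mpol"
  assumes "p = CHAR('a)" "p > 0"
  shows "Poly_Mapping.lookup (H ^ p) (scale p m) = Poly_Mapping.lookup H m ^ p"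
  by (simp add: power_CHAR_mpoly[OF assms] lookup_var_power lookup_frob assms(2))

lemma pderiv_zero_imp_compose_power:
  fixes u :: "'a::field poly"
  assumes p: "p = CHAR('a)" "p > 0" and u: "pderiv u = 0"
  obtains v where "u = pcompose v (monom 1 p)" and "\<And>i. coeff v i \<in> range (coeff u)"
proof -
  define v where "v = Abs_poly (\<lambda>i. coeff u (p * i))"
  have v: "coeff v i = coeff u (p * i)" for i
    unfolding v_def
  proof (subst coeff_Abs_poly[of "degree u"])
    fix i assume "i > degree u"
    also have "i \<le> p * i" using p(2) by simp
    finally show "coeff u (p * i) = 0" by (rule coeff_eq_0)
  qed simp
  have u0: "coeff u n = 0" if n: "\<not> p dvd n" for n
  proof -
    obtain k where k: "n = Suc k" using n by (cases n) auto
    have "of_nat n * coeff u n = 0"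
      using u by (metis coeff_0 coeff_pderiv k)
    moreover have "of_nat n \<noteq> (0::'a)" using n p(1) by (simp add: of_nat_eq_0_iff_char_dvd)
    ultimately show ?thesis by simp
  qed
  have "u = pcompose v (monom 1 p)"
  proof (rule poly_eqI)
    fix n
    have "pcompose v (monom 1 p) = (\<Sum>i\<le>degree v. monom (coeff v i) (p * i))"
      by (simp add: pcompose_eq_peval peval_altdef[OF comm_ring_hom_const_poly] monom_power smult_monom)
    then have *: "coeff (pcompose v (monom 1 p)) n = (\<Sum>i\<le>degree v. if p * i = n then coeff v i else 0)"
      by (simp add: coeff_sum)
    show "coeff u n = coeff (pcompose v (monom 1 p)) n"
    proof (cases "p dvd n")
      case True
      then obtain k where k: "n = p * k" by (elim dvdE)
      have "(\<Sum>i\<le>degree v. if p * i = n then coeff v i else 0) = (\<Sum>i\<le>degree v. if i = k then coeff v k else 0)"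
        using p(2) by (intro sum.cong) (auto simp: k)
      also have "\<dots> = coeff u n" by (simp add: coeff_eq_0 k flip: v)
      finally show ?thesis unfolding * by (rule sym)
    next
      case False
      then show ?thesis unfolding * using u0 by (intro trans[OF _ sum.neutral[symmetric]]) auto
    qed
  qed
  then show thesis using that v by auto
qed

lemma degree_eq_1E:
  assumes "degree p = 1"
  obtains a b where "p = [:a, b:]"
  using assms by (cases p rule: pCons_cases) (auto split: if_splits elim: degree_eq_zeroE)

lemma mpoly_nonconst_key:
  assumes "F \<notin> range mpoly_const"
  obtains m j where "m \<in> Poly_Mapping.keys F" and "Poly_Mapping.lookup m j > 0"
proof -
  have "\<exists>m\<in>Poly_Mapping.keys F. m \<noteq> 0"
  proof (rule ccontr)
    assume "\<not> ?thesis"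
    then have "Poly_Mapping.lookup F m = 0" if "m \<noteq> 0" for m using that by (auto simp: in_keys_iff)
    then have "F = mpoly_const (Poly_Mapping.lookup F 0)"
      by (intro poly_mapping_eqI) (auto simp: mpoly_const_def lookup_single when_def)
    with assms show False by auto
  qed
  then obtain m where m: "m \<in> Poly_Mapping.keys F" "m \<noteq> 0" by blast
  then obtain j where "Poly_Mapping.lookup m j \<noteq> 0" by (metis lookup_zero poly_mapping_eqI)
  with m that show thesis by blast
qed

text \<open>Induction on a bound for the exponents of \<open>F\<close>. If \<open>F\<close> restricts to some curve with non-zero derivative,
\<open>separable_descent\<close> applies. Otherwise \<open>F = F1(x\<^sup>p)\<close>. If \<open>u' \<noteq> 0\<close>, the chain rule on curves shows that \<open>H\<close> has
no exponent prime to \<open>p\<close> either, so \<open>H = H1(x\<^sup>p)\<close> and \<open>F1 = u(H1)\<close>. If \<open>u = v(t\<^sup>p)\<close>, then \<open>F1 = v(H1)\<close> for the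
polynomial \<open>H1\<close> with \<open>H\<^sup>p = H1(x\<^sup>p)\<close>, and the induction hypothesis applies unless \<open>deg v = 1\<close>; in that case
\<open>F\<close> is affine in \<open>H\<^sup>p\<close> over \<open>E\<close>, and normalizing \<open>H\<close> moves the coefficients into \<open>K\<close>.\<close>

lemma decomposition_descends_or_power:
  fixes F :: "(nat, 'a::field) mpol"
  assumes K: "is_subfield K" and E: "is_subfield E" and KE: "K \<subseteq> E"
    and F: "F \<in> mpoly_ring K V" "F \<notin> range mpoly_const"
    and H: "H \<in> mpoly_ring E V" and u: "u \<in> polys_over E" "degree u \<ge> 2"
    and comp: "F = mpoly_compose u H"
  shows "(\<exists>Q\<in>mpoly_ring K V. \<exists>a\<in>polys_over K. degree a \<ge> 2 \<and> F = mpoly_compose a Q) \<or>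
    (CHAR('a) > 0 \<and> (\<exists>G\<in>mpoly_ring E V. \<exists>b\<in>K. \<exists>c\<in>K.
      F = mpoly_const b * G ^ CHAR('a) + mpoly_const c))"
proof -
  let ?p = "CHAR('a)"
  interpret const: comm_ring_hom "mpoly_const :: 'a \<Rightarrow> (nat, 'a) mpol" by (rule comm_ring_hom_mpoly_const)
  have "?thesis" if "\<And>m j. m \<in> Poly_Mapping.keys F \<Longrightarrow> Poly_Mapping.lookup m j \<le> n" for n
    using that F H u comp
  proof (induction n arbitrary: F H u rule: less_induct)
    case (less n)
    note F = less.prems(2,3) and H = less.prems(4) and u = less.prems(5,6) and comp = less.prems(7)
    show ?case
    proof (cases "\<exists>m\<in>Poly_Mapping.keys F. \<exists>j. of_nat (Poly_Mapping.lookup m j) \<noteq> (0::'a)")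
      case True
      then obtain N where N: "\<And>v. N v > 0" "pderiv (curve N F) \<noteq> 0"
        using pderiv_curve_nonzero by metis
      interpret fibration K V N F by unfold_locales (use K F N in auto)
      show ?thesis using separable_descent[OF u(2) H comp] by blast
    next
      case False
      then have F0: "of_nat (Poly_Mapping.lookup m j) = (0::'a)" if "m \<in> Poly_Mapping.keys F" for m j
        using that by blast
      obtain m j where mj: "m \<in> Poly_Mapping.keys F" "Poly_Mapping.lookup m j > 0"
        using mpoly_nonconst_key[OF F(2)] by blast
      have pos: "?p > 0"
        using F0[OF mj(1), of j] mj(2) by (auto simp: of_nat_eq_0_iff_char_dvd intro: gr0I)
      then have prime: "prime ?p" using prime_CHAR_semidom by blast
      have n: "n > 0" using less.prems(1)[OF mj(1), of j] mj(2) by simp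
      obtain F1 where F1: "F1 \<in> mpoly_ring K V" "F = var_power ?p F1"
        using var_power_preimage[OF K F(1)] F0 by (metis of_nat_eq_0_iff_char_dvd)
      have F1_nonconst: "F1 \<notin> range mpoly_const" using F(2) F1(2) by (auto simp: var_power_const)
      have F1_bound: "Poly_Mapping.lookup m j \<le> n div ?p" if "m \<in> Poly_Mapping.keys F1" for m j
      proof -
        have "scale ?p m \<in> Poly_Mapping.keys F"
          using that by (simp add: in_keys_iff F1(2) lookup_var_power[OF pos])
        then have "?p * Poly_Mapping.lookup m j \<le> n"
          using less.prems(1)[of "scale ?p m" j] by (simp add: lookup_scale)
        then show ?thesis by (simp add: less_eq_div_iff_mult_less_eq pos mult.commute)
      qed
      have smaller: "n div ?p < n" using n prime_gt_1_nat[OF prime] by simp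
      have lift: ?thesis if H1: "H1 \<in> mpoly_ring E V" and w: "w \<in> polys_over E" "degree w \<ge> 2"
        and F1_comp: "F1 = mpoly_compose w H1" for H1 w
        using less.IH[OF smaller F1_bound F1(1) F1_nonconst H1 w F1_comp]
      proof
        assume "\<exists>Q\<in>mpoly_ring K V. \<exists>a\<in>polys_over K. degree a \<ge> 2 \<and> F1 = mpoly_compose a Q"
        then obtain Q a where Qa: "Q \<in> mpoly_ring K V" "a \<in> polys_over K" "degree a \<ge> 2"
          "F1 = mpoly_compose a Q" by blast
        have "F = mpoly_compose a (var_power ?p Q)"
          by (simp add: F1(2) Qa(4) var_power_compose)
        then show ?thesis using Qa var_power_mpoly_ring[OF K Qa(1)] by blast
      next
        assume "?p > 0 \<and> (\<exists>G\<in>mpoly_ring E V. \<exists>b\<in>K. \<exists>c\<in>K. F1 = mpoly_const b * G ^ ?p + mpoly_const c)"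
        then obtain G b c where G: "G \<in> mpoly_ring E V" "b \<in> K" "c \<in> K"
          "F1 = mpoly_const b * G ^ ?p + mpoly_const c" by blast
        interpret vp: comm_ring_hom "var_power ?p" by (rule comm_ring_hom_var_power)
        have "F = mpoly_const b * var_power ?p G ^ ?p + mpoly_const c"
          by (simp add: F1(2) G(4) vp.hom_add vp.hom_mult vp.hom_power var_power_const)
        then show ?thesis using G pos var_power_mpoly_ring[OF E G(1)] by blast
      qed
      show ?thesis
      proof (cases "pderiv u = 0")
        case False
        have H0: "of_nat (Poly_Mapping.lookup m j) = (0::'a)" if mH: "m \<in> Poly_Mapping.keys H" for m j
        proof (rule ccontr)
          assume "of_nat (Poly_Mapping.lookup m j) \<noteq> (0::'a)"
          then obtain N where N: "pderiv (curve N H) \<noteq> 0" using pderiv_curve_nonzero[OF mH] by metis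
          then have "degree (curve N H) > 0" by (intro gr0I) (auto elim!: degree_eq_zeroE simp: pderiv_pCons)
          then have "pcompose (pderiv u) (curve N H) \<noteq> 0" using False by (simp add: pcompose_eq_0_iff)
          then have "pderiv (curve N F) \<noteq> 0" using N by (simp add: comp curve_compose pderiv_pcompose)
          moreover have "pderiv (curve N F) = 0" by (rule pderiv_curve_zero) (rule F0)
          ultimately show False by simp
        qed
        obtain H1 where H1: "H1 \<in> mpoly_ring E V" "H = var_power ?p H1"
          using var_power_preimage[OF E H] H0 by (metis of_nat_eq_0_iff_char_dvd)
        have "F1 = mpoly_compose u H1"
          by (rule var_power_inj[OF pos]) (simp add: var_power_compose flip: F1(2) H1(2) comp)
        then show ?thesis by (rule lift[OF H1(1) u])
      next
        case True
        obtain v where v: "u = pcompose v (monom 1 ?p)" "\<And>i. coeff v i \<in> range (coeff u)"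
          using pderiv_zero_imp_compose_power[OF refl pos True] by blast
        have "coeff v i \<in> E" for i using v(2)[of i] u(1) by (auto simp: polys_over_def)
        then have vE: "v \<in> polys_over E" by (simp add: polys_over_def)
        have "mpoly_compose u H = mpoly_compose v (H ^ ?p)"
        proof -
          have "peval mpoly_const H (monom 1 ?p) = H ^ ?p"
            by (simp add: peval_def map_poly_monom const.hom_zero const.hom_one poly_monom)
          then show ?thesis
            by (simp add: mpoly_compose_eq_peval v(1) peval_peval[OF comm_ring_hom_mpoly_const])
        qed
        then have Fv: "F = mpoly_compose v (H ^ ?p)" using comp by simp
        show ?thesis
        proof (cases "degree v \<ge> 2")
          case True
          have "F1 = mpoly_compose v (frob ?p H)"
            by (rule var_power_inj[OF pos])
              (simp add: var_power_compose flip: F1(2) power_CHAR_mpoly[OF refl pos] Fv)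
          then show ?thesis by (rule lift[OF frob_mpoly_ring[OF E pos H] vE True])
        next
          case False
          have "degree v \<noteq> 0" using u(2) unfolding v(1) degree_pcompose by (intro notI) simp
          then have "degree v = 1" using False by simp
          then obtain v0 v1 where v01: "v = [:v0, v1:]" by (rule degree_eq_1E)
          have Fv01: "F = mpoly_const v0 + mpoly_const v1 * H ^ ?p"
            by (simp add: Fv v01 mpoly_compose_def map_poly_pCons const.hom_zero mult.commute)
          have "H \<notin> range mpoly_const"
          proof
            assume "H \<in> range mpoly_const"
            then obtain a where "H = mpoly_const a" by auto
            then have "F = mpoly_const (v0 + v1 * a ^ ?p)"
              by (simp add: Fv01 const.hom_add const.hom_mult const.hom_power)
            with F(2) show False by simp
          qed
          then obtain m j where m: "m \<in> Poly_Mapping.keys H" "Poly_Mapping.lookup m j > 0"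
            by (rule mpoly_nonconst_key)
          \<comment> \<open>Normalize \<open>H\<close> to have constant term \<open>0\<close> and coefficient \<open>1\<close> at \<open>m\<close>; then \<open>b\<close> and \<open>c\<close> are coefficients of \<open>F\<close>.\<close>
          define a where "a = Poly_Mapping.lookup H m"
          define e where "e = Poly_Mapping.lookup H 0"
          have a: "a \<noteq> 0" using m(1) by (simp add: a_def in_keys_iff)
          have ae: "a \<in> E" "e \<in> E" using mpoly_ring_lookup[OF E H] by (auto simp: a_def e_def)
          define G where "G = mpoly_const (inverse a) * (H - mpoly_const e)"
          have G: "G \<in> mpoly_ring E V"
            unfolding G_def using ae E
            by (intro subring_mult[OF is_subring_mpoly_ring[OF E]] subring_diff[OF is_subring_mpoly_ring[OF E]]
                H mpoly_ring_const[OF E]) (auto simp: is_subfield_def)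
          have scale0: "scale ?p 0 = 0" by (rule poly_mapping_eqI) (simp add: lookup_scale)
          have scalem: "scale ?p m \<noteq> 0"
            using m(2) pos by (auto simp: poly_mapping_eq_iff fun_eq_iff lookup_scale intro!: exI[of _ j])
          have lookF: "Poly_Mapping.lookup F k = (v0 when k = 0) + v1 * Poly_Mapping.lookup (H ^ ?p) k" for k
            by (simp add: Fv01 lookup_add lookup_mpoly_const_mult) (simp add: mpoly_const_def lookup_single when_def)
          have "Poly_Mapping.lookup F (scale ?p m) = v1 * a ^ ?p"
            using scalem by (simp add: lookF lookup_power_CHAR[OF refl pos] a_def)
          then have bK: "v1 * a ^ ?p \<in> K" using mpoly_ring_lookup[OF K F(1)] by metis
          have "Poly_Mapping.lookup F (scale ?p 0) = v0 + v1 * e ^ ?p"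
            unfolding lookF lookup_power_CHAR[OF refl pos] by (simp add: scale0 e_def)
          then have cK: "v0 + v1 * e ^ ?p \<in> K" using mpoly_ring_lookup[OF K F(1)] by metis
          have "H = mpoly_const a * G + mpoly_const e"
          proof -
            have "mpoly_const a * G = mpoly_const (a * inverse a) * (H - mpoly_const e)"
              unfolding G_def by (simp only: const.hom_mult mult.assoc)
            then show ?thesis using a by (simp add: const.hom_one)
          qed
          then have "H ^ ?p = (mpoly_const a * G + mpoly_const e) ^ ?p" by (rule arg_cong)
          also have "\<dots> = (mpoly_const a * G) ^ ?p + mpoly_const e ^ ?p"
            by (rule freshmans_dream) (simp_all add: CHAR_mpoly prime)
          finally have "F = mpoly_const (v1 * a ^ ?p) * G ^ ?p + mpoly_const (v0 + v1 * e ^ ?p)"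
            by (simp add: Fv01 const.hom_add const.hom_mult const.hom_power power_mult_distrib algebra_simps)
          then show ?thesis using G bK cK pos by blast
        qed
      qed
    qed
  qed
  moreover obtain n where "\<And>m j. m \<in> Poly_Mapping.keys F \<Longrightarrow> Poly_Mapping.lookup m j \<le> n"
  proof
    fix m j assume m: "m \<in> Poly_Mapping.keys F"
    show "Poly_Mapping.lookup m j \<le> (\<Sum>m\<in>Poly_Mapping.keys F. \<Sum>j\<in>Poly_Mapping.keys m. Poly_Mapping.lookup m j)"
    proof (cases "j \<in> Poly_Mapping.keys m")
      case True
      then have "Poly_Mapping.lookup m j \<le> (\<Sum>j\<in>Poly_Mapping.keys m. Poly_Mapping.lookup m j)"
        by (intro member_le_sum) auto
      also have "\<dots> \<le> (\<Sum>m\<in>Poly_Mapping.keys F. \<Sum>j\<in>Poly_Mapping.keys m. Poly_Mapping.lookup m j)"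
        using m by (intro member_le_sum[of m _ "\<lambda>m. \<Sum>j\<in>Poly_Mapping.keys m. Poly_Mapping.lookup m j"]) auto
      finally show ?thesis .
    qed (simp add: in_keys_iff)
  qed
  ultimately show ?thesis by blast
qed

section \<open>Inseparability\<close>

lemma mpoly_eval_eq_meval: "mpoly_eval g P = meval (\<lambda>a. a) g P"
  by (simp add: mpoly_eval_def meval_def mono_eval_def)

lemma dvd_prime_power_imp_unit:
  fixes q x :: "'r::idom"
  assumes "prime_elem x" and "\<not> x dvd q" and "q dvd x ^ n"
  shows "q dvd 1"
  using assms(3)
proof (induction n)
  case (Suc n)
  then obtain y where y: "x ^ Suc n = q * y" by (elim dvdE)
  then have "x dvd q * y" by (metis dvd_triv_left power_Suc)
  then have "x dvd y" using assms(1,2) by (simp add: prime_elem_dvd_mult_iff)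
  then obtain z where "y = x * z" by (elim dvdE)
  then have "x * x ^ n = x * (q * z)" using y by (simp add: mult_ac)
  then have "x ^ n = q * z" using assms(1) by (simp add: prime_elem_def)
  then show ?case using Suc.IH by simp
qed simp

text \<open>The minimal polynomial divides \<open>X\<^sup>p - g\<^sup>p = (X - g)\<^sup>p\<close>, so it is a power of \<open>X - g\<close>, up to a unit. Its degree is
not \<open>1\<close> because \<open>g \<notin> K\<close>, so \<open>(X - g)\<^sup>2\<close> divides it and \<open>X - g\<close> divides its derivative.\<close>

lemma purely_inseparable_not_separable_over:
  fixes g :: "'a::field"
  assumes K: "is_subfield K" and p: "p = CHAR('a)" "p > 0" and g: "g \<notin> K" "g ^ p \<in> K"
  shows "\<not> separable_over K g"
proof
  assume "separable_over K g"
  then obtain P where P: "P \<in> poly_ring K" "lead_coeff P = 1" "poly P g = 0"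
    and min: "\<And>Q. Q \<in> poly_ring K \<Longrightarrow> Q \<noteq> 0 \<Longrightarrow> poly Q g = 0 \<Longrightarrow> degree P \<le> degree Q"
    and cop: "coprime P (pderiv P)"
    by (auto simp: separable_over_def is_min_poly_def)
  have prime: "prime p" using p prime_CHAR_semidom by blast
  note SK = is_subring_subfield[OF K]
  note SP = is_subring_polys_over[OF SK]
  let ?x = "[:-g, 1:]"
  have Pnz: "P \<noteq> 0" using P(2) by auto
  have degP: "degree P \<noteq> 1"
  proof
    assume "degree P = 1"
    then obtain c0 c1 where c: "P = [:c0, c1:]" by (rule degree_eq_1E)
    with P(2) \<open>degree P = 1\<close> have "c1 = 1" by simp
    with c P(3) have "g = - c0" by (simp add: eq_neg_iff_add_eq_0 add.commute)
    moreover have "c0 \<in> K" using P(1) c by (metis coeff_pCons_0 mem_Collect_eq poly_ring_def)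
    ultimately show False using g(1) subring_uminus[OF SK] by simp
  qed
  have degP0: "degree P \<noteq> 0"
  proof
    assume "degree P = 0"
    then obtain a where "P = [:a:]" by (rule degree_eq_zeroE)
    with P(2,3) show False by simp
  qed
  define Q where "Q = monom 1 p - [:g ^ p:]"
  have QK: "Q \<in> polys_over K"
    unfolding Q_def using g(2)
    by (intro subring_diff[OF SP] monom_polys_over[OF SK])
      (auto simp: polys_over_pCons[OF SK] subring_0[OF SP] subring_1[OF SK])
  have Qg: "poly Q g = 0" by (simp add: Q_def poly_monom)
  have Qx: "Q = ?x ^ p"
  proof -
    have "(?x + [:g:]) ^ p = ?x ^ p + [:g:] ^ p"
      using prime p by (intro freshmans_dream) simp_all
    moreover have "?x + [:g:] = monom 1 1" by (simp add: monom_Suc monom_0)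
    moreover have "[:g:] ^ p = [:g ^ p:]" by (rule poly_const_pow)
    ultimately show ?thesis by (simp add: Q_def monom_power algebra_simps)
  qed
  obtain e A R where R: "R \<in> polys_over K" and eq: "smult (lead_coeff P ^ e) Q = A * P + R"
    and deg: "R = 0 \<or> degree R < degree P"
    using pseudo_division[OF SK QK] P(1) Pnz unfolding poly_ring_eq_polys_over by metis
  have eq': "Q = A * P + R" using eq P(2) by simp
  then have "poly R g = 0" using Qg P(3) by simp
  then have "R = 0" using min[of R] R deg unfolding poly_ring_eq_polys_over by linarith
  then have PQ: "P dvd ?x ^ p" using eq' Qx by simp
  have xprime: "prime_elem ?x" by (rule field_poly_irreducible_imp_prime, rule irreducible_linear_field_poly) simp
  obtain P2 where P2: "P = ?x ^ order g P * P2" "\<not> ?x dvd P2" using order_decomp[OF Pnz] by blast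
  have "P2 dvd ?x ^ p" using PQ P2(1) by (metis dvd_mult_right)
  then have "P2 dvd 1" by (rule dvd_prime_power_imp_unit[OF xprime P2(2)])
  moreover have "P2 \<noteq> 0" using P2(1) Pnz by auto
  ultimately have "degree P2 = 0" by (simp add: is_unit_iff_degree)
  then have "degree P = order g P"
    using P2(1) \<open>P2 \<noteq> 0\<close> degree_mult_eq[of "?x ^ order g P" P2] by (simp add: degree_power_eq)
  then have "order g P \<ge> 2" using degP degP0 by simp
  then obtain k where k: "order g P = Suc (Suc k)" by (metis Suc_le_D numeral_2_eq_2 le_Suc_ex add_Suc)
  have "P = ?x * (?x * (?x ^ k * P2))" using P2(1) k by (simp only: power_Suc mult_ac)
  then obtain Z where Z: "P = ?x * (?x * Z)" by blast
  have "pderiv P = ?x * pderiv (?x * Z) + (?x * Z) * pderiv ?x"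
    unfolding Z by (rule pderiv_mult)
  then have "pderiv P = ?x * (pderiv (?x * Z) + Z * pderiv ?x)" by (simp only: distrib_left mult_ac)
  then have "?x dvd pderiv P" by (rule dvdI)
  moreover have "?x dvd P" using Z by (rule dvdI)
  ultimately have "?x dvd 1" using cop coprime_common_divisor by blast
  then show False using xprime by (simp add: prime_elem_def)
qed

text \<open>The \<open>p\<close>-th power of every element of \<open>K(g)\<close> lies in \<open>K\<close>. So every element \<open>b\<close> is a root of \<open>X\<^sup>p - b\<^sup>p\<close>, a
transcendence basis of \<open>K(g)\<close> is empty, and \<open>g\<close> would have to be separable over \<open>K\<close> itself.\<close>

lemma pth_root_not_separable:
  fixes g :: "'a::field"
  assumes K: "is_subfield K" and p: "p = CHAR('a)" "p > 0"
    and g: "g \<in> E" "g \<notin> K" "g ^ p \<in> K"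
  shows "\<not> separable_extension K E"
proof
  assume "separable_extension K E"
  then have "separably_generated K (adjoin K {g})"
    using g(1) by (simp add: separable_extension_def)
  then obtain B where B: "B \<subseteq> adjoin K {g}" "alg_independent K B"
    and sep: "\<And>x. x \<in> adjoin K {g} \<Longrightarrow> separable_over (adjoin K B) x"
    by (auto simp: separably_generated_def)
  have prime: "prime CHAR('a)" and prime': "prime p" using p prime_CHAR_semidom by blast+
  note SK = is_subring_subfield[OF K]
  have "is_subfield {x. x ^ p \<in> K}"
    using K subring_uminus[OF SK] minus_power_prime_CHAR[OF p(1) prime']
    unfolding is_subfield_def
    by (auto simp: freshmans_dream[OF prime p(1)] power_mult_distrib power_inverse zero_power[OF p(2)])
  moreover have "K \<union> {g} \<subseteq> {x. x ^ p \<in> K}" using g(3) subring_power[OF SK] by auto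
  ultimately have adjoin_p: "x ^ p \<in> K" if "x \<in> adjoin K {g}" for x
    using that by (auto simp: adjoin_def)
  have "B = {}"
  proof (rule ccontr)
    assume "B \<noteq> {}"
    then obtain b where b: "b \<in> B" by blast
    define P :: "('a, 'a) mpol" where "P = mvar b ^ p - mpoly_const (b ^ p)"
    have "P \<in> mpoly_ring K B"
      unfolding P_def using b B(1) adjoin_p
      by (intro subring_diff[OF is_subring_mpoly_ring[OF K]] subring_power[OF is_subring_mpoly_ring[OF K]]
          mpoly_ring_mvar[OF K] mpoly_ring_const[OF K]) auto
    have id: "comm_ring_hom (\<lambda>a::'a. a)" by unfold_locales simp_all
    interpret ev: comm_ring_hom "meval (\<lambda>a. a) (\<lambda>b::'a. b)" by (rule comm_ring_hom_meval[OF id])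
    have "mpoly_eval (\<lambda>b. b) P = 0"
      by (simp add: mpoly_eval_eq_meval P_def ev.hom_diff ev.hom_power meval_var[OF id] meval_const[OF id])
    then have P0: "P = 0" using B(2) \<open>P \<in> mpoly_ring K B\<close> by (auto simp: alg_independent_def)
    have "mvar b ^ p = (Poly_Mapping.single (Poly_Mapping.single b p) 1 :: ('a, 'a) mpol)"
      using mono_eval_mvar[of "Poly_Mapping.single b p"] by simp
    moreover have "Poly_Mapping.single b p \<noteq> 0"
      using p(2) by (metis less_irrefl lookup_single_eq lookup_zero)
    ultimately have "Poly_Mapping.lookup P (Poly_Mapping.single b p) = 1"
      by (simp add: P_def lookup_minus mpoly_const_def lookup_single when_def)
    with P0 show False by simp
  qed
  moreover have "adjoin K {} = K" using K by (auto simp: adjoin_def)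
  moreover have "g \<in> adjoin K {g}" by (auto simp: adjoin_def)
  ultimately have "separable_over K g" using sep[of g] by simp
  with purely_inseparable_not_separable_over[OF K p g(2,3)] show False by simp
qed

section \<open>Polynomials that become decomposable over an extension\<close>

lemma indecomposable_affine:
  assumes K: "is_subfield K" and F: "indecomposable K V F"
    and P: "P \<in> mpoly_ring K V" and bc: "b \<in> K" "c \<in> K" "F = mpoly_const b * P + mpoly_const c"
  shows "indecomposable K V P"
proof -
  interpret const: comm_ring_hom "mpoly_const :: 'a \<Rightarrow> ('b, 'a) mpol" by (rule comm_ring_hom_mpoly_const)
  note SK = is_subring_subfield[OF K]
  have nonconst: "F \<notin> range mpoly_const" using F by (simp add: indecomposable_def)
  have bnz: "b \<noteq> 0" using nonconst bc(3) by (auto simp: const.hom_zero)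
  have "P \<notin> range mpoly_const"
  proof
    assume "P \<in> range mpoly_const"
    then obtain a where "P = mpoly_const a" by auto
    then have "F = mpoly_const (b * a + c)" by (simp add: bc(3) const.hom_add const.hom_mult)
    with nonconst show False by simp
  qed
  moreover have "\<not> (\<exists>H\<in>mpoly_ring K V. \<exists>u\<in>poly_ring K. degree u \<ge> 2 \<and> P = mpoly_compose u H)"
  proof
    assume "\<exists>H\<in>mpoly_ring K V. \<exists>u\<in>poly_ring K. degree u \<ge> 2 \<and> P = mpoly_compose u H"
    then obtain H u where H: "H \<in> mpoly_ring K V" and u: "u \<in> poly_ring K" "degree u \<ge> 2"
      and eq: "P = mpoly_compose u H" by blast
    interpret ev: comm_ring_hom "peval mpoly_const H" by (rule comm_ring_hom_peval[OF comm_ring_hom_mpoly_const])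
    let ?u = "[:b:] * u + [:c:]"
    have "F = mpoly_compose ?u H"
      by (simp only: bc(3) eq mpoly_compose_eq_peval ev.hom_add ev.hom_mult
          peval_const[OF comm_ring_hom_mpoly_const])
    moreover have "degree ?u = degree u"
      using u(2) bnz by (subst degree_add_eq_left) auto
    moreover have "?u \<in> poly_ring K"
      using u(1) bc unfolding poly_ring_eq_polys_over
      by (intro subring_add[OF is_subring_polys_over[OF SK]] subring_mult[OF is_subring_polys_over[OF SK]])
        (auto simp: polys_over_pCons[OF SK] subring_0[OF is_subring_polys_over[OF SK]])
    ultimately show False using F H u(2) unfolding indecomposable_def by (metis (no_types, lifting))
  qed
  ultimately show ?thesis using P by (simp add: indecomposable_def)
qed

lemma affine_power_eq_compose:
  fixes G :: "('v, 'a::field) mpol"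
  assumes K: "is_subfield K" and bc: "b \<in> K" "c \<in> K" "b \<noteq> 0" and p: "p \<ge> 2"
  obtains u where "u \<in> poly_ring K" and "degree u \<ge> 2"
    and "mpoly_const b * G ^ p + mpoly_const c = mpoly_compose u G"
proof
  interpret ev: comm_ring_hom "peval mpoly_const G" by (rule comm_ring_hom_peval[OF comm_ring_hom_mpoly_const])
  note SK = is_subring_subfield[OF K]
  let ?u = "[:b:] * [:0, 1:] ^ p + [:c:]"
  have deg: "degree ([:b:] * [:0, 1:] ^ p) = p" using bc(3) by (simp add: degree_power_eq)
  show "degree ?u \<ge> 2" using p deg by (subst degree_add_eq_left) auto
  show "?u \<in> poly_ring K"
    using bc unfolding poly_ring_eq_polys_over
    by (intro subring_add[OF is_subring_polys_over[OF SK]] subring_mult[OF is_subring_polys_over[OF SK]]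
        subring_power[OF is_subring_polys_over[OF SK]])
      (auto simp: polys_over_pCons[OF SK] subring_0[OF SK] subring_1[OF SK]
        subring_0[OF is_subring_polys_over[OF SK]])
  show "mpoly_const b * G ^ p + mpoly_const c = mpoly_compose ?u G"
    by (simp only: mpoly_compose_eq_peval ev.hom_add ev.hom_mult ev.hom_power
        peval_const[OF comm_ring_hom_mpoly_const] peval_X[OF comm_ring_hom_mpoly_const])
qed

theorem theorem4p2:
  fixes n :: nat and K E :: "'a::field set" and F :: "(nat, 'a) mpol"
  assumes "n \<ge> 2"
    and "is_subfield K" and "is_subfield E" and "K \<subseteq> E"
    and "F \<in> mpoly_ring K {1..n}" and "F \<notin> range mpoly_const"
  shows "(indecomposable K {1..n} F \<and> decomposable E {1..n} F) \<longleftrightarrow>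
    (\<exists>p. p = CHAR('a) \<and> p > 0 \<and> \<not> separable_extension K E \<and>
      (\<exists>G\<in>mpoly_ring E {1..n}. \<exists>b\<in>K. \<exists>c\<in>K.
         F = mpoly_const b * G ^ p + mpoly_const c \<and>
         indecomposable K {1..n} (G ^ p)))"
    (is "?descent \<longleftrightarrow> ?power")
proof -
  note K = assms(2) and E = assms(3)
  let ?V = "{1..n}" and ?p = "CHAR('a)"
  interpret const: comm_ring_hom "mpoly_const :: 'a \<Rightarrow> (nat, 'a) mpol" by (rule comm_ring_hom_mpoly_const)
  note SM = is_subring_mpoly_ring[OF K, of ?V]
  show ?thesis
  proof
    assume ?descent
    then have indec: "indecomposable K ?V F" and "decomposable E ?V F" by simp_all
    then obtain H u where "H \<in> mpoly_ring E ?V" "u \<in> polys_over E" "degree u \<ge> 2" "F = mpoly_compose u H"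
      by (auto simp: decomposable_def poly_ring_eq_polys_over)
    from decomposition_descends_or_power[OF K E assms(4-6) this] indec
    obtain G b c where p: "?p > 0" and G: "G \<in> mpoly_ring E ?V" and bc: "b \<in> K" "c \<in> K"
      and F: "F = mpoly_const b * G ^ ?p + mpoly_const c"
      by (auto simp: indecomposable_def poly_ring_eq_polys_over)
    have prime: "prime ?p" using p prime_CHAR_semidom by blast
    have b: "b \<noteq> 0" using assms(6) F by (auto simp: const.hom_zero)
    have "G ^ ?p = mpoly_const (inverse b) * (F - mpoly_const c)"
    proof -
      have "mpoly_const (inverse b) * (F - mpoly_const c) = mpoly_const (inverse b * b) * G ^ ?p"
        by (simp add: F const.hom_mult mult.assoc)
      then show ?thesis using b by (simp add: const.hom_one)
    qed
    also have "\<dots> \<in> mpoly_ring K ?V"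
      using bc assms(5) K
      by (intro subring_mult[OF SM] subring_diff[OF SM] mpoly_ring_const[OF K]) (auto simp: is_subfield_def)
    finally have GpK: "G ^ ?p \<in> mpoly_ring K ?V" .
    have "G \<notin> mpoly_ring K ?V"
    proof
      assume "G \<in> mpoly_ring K ?V"
      moreover obtain u where "u \<in> poly_ring K" "degree u \<ge> 2" "F = mpoly_compose u G"
        using affine_power_eq_compose[OF K bc b prime_ge_2_nat[OF prime], of G] F by metis
      ultimately show False using indec unfolding indecomposable_def by blast
    qed
    then obtain m where m: "m \<in> Poly_Mapping.keys G" "Poly_Mapping.lookup G m \<notin> K"
      using G by (auto simp: mpoly_ring_def)
    have "Poly_Mapping.lookup G m ^ ?p \<in> K"
      using mpoly_ring_lookup[OF K GpK] lookup_power_CHAR[OF refl p] by metis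
    then have "\<not> separable_extension K E"
      using pth_root_not_separable[OF K refl p _ m(2)] mpoly_ring_lookup[OF E G] by blast
    moreover have "indecomposable K ?V (G ^ ?p)" by (rule indecomposable_affine[OF K indec GpK bc F])
    ultimately show ?power using p G bc F by blast
  next
    assume ?power
    then obtain G b c where p: "?p > 0" and G: "G \<in> mpoly_ring E ?V" and bc: "b \<in> K" "c \<in> K"
      and F: "F = mpoly_const b * G ^ ?p + mpoly_const c" and indec: "indecomposable K ?V (G ^ ?p)"
      by blast
    have prime: "prime ?p" using p prime_CHAR_semidom by blast
    have b: "b \<noteq> 0" using assms(6) F by (auto simp: const.hom_zero)
    have "G ^ ?p = mpoly_const (inverse b) * F + mpoly_const (- inverse b * c)"
    proof -
      have "mpoly_const (inverse b) * F = mpoly_const (inverse b * b) * G ^ ?p + mpoly_const (inverse b * c)"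
        by (simp add: F const.hom_mult distrib_left mult.assoc)
      then show ?thesis using b by (simp add: const.hom_one const.hom_uminus)
    qed
    moreover have "inverse b \<in> K" "- inverse b * c \<in> K"
      using K bc by (simp_all add: is_subfield_def)
    ultimately have "indecomposable K ?V F"
      using indecomposable_affine[OF K indec assms(5)] by blast
    moreover have "decomposable E ?V F"
    proof -
      obtain u where "u \<in> poly_ring E" "degree u \<ge> 2" "F = mpoly_compose u G"
        using affine_power_eq_compose[OF E _ _ b prime_ge_2_nat[OF prime], of c G] F bc assms(4) by blast
      moreover have "F \<in> mpoly_ring E ?V" using assms(4,5) by (auto simp: mpoly_ring_def)
      ultimately show ?thesis using G assms(6) unfolding decomposable_def by blast
    qed
    ultimately show ?descent by simp
  qed
qed

end
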